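(* Let $a,b$ be integers with $2\le a<b$, let $p,\tilde p>0$ be real, let $q,\tilde q$ be even integers with $2\le q\le b$ and $2\le\tilde q\le a$, and let $$f(x,y)=x^ay^b+x^{a}y^{b-q}e^{-1/|x|^p}+x^{a-\tilde q}y^{b}e^{-1/|y|^{\tilde p}}$$ (with the exponentials set equal to $0$ at $x=0$, respectively $y=0$). Let $U$ be a sufficiently small open neighborhood of the origin in $\mathbb{R}^2$. Then for every real-valued $\varphi\in C_0^\infty(U)$ with $\varphi(0,0)>0$ and $\varphi\ge 0$ on $U$, the function $Z_f(\varphi)(s)$ (holomorphic on $\mathrm{Re}(s)>-1/b$) cannot be meromorphically continued to any open neighborhood of $s=-1/b$ in $\mathbb{C}$. In particular, $m_0(f)=1/b$.
   Context: $C_0^\infty(U)$ is the set of smooth functions with compact support contained in $U$; "sufficiently small" means contained in some ball about the origin whose radius depends only on $f$. For $\varphi\in C_0^\infty(U)$, $Z_f(\varphi)(s)=\int_{\mathbb{R}^2}|f(x,y)|^s\varphi(x,y)\,dx\,dy$; for the $f$ considered it converges and is holomorphic on $\mathrm{Re}(s)>-1/b$. Put $$m_0(f,\varphi):=\sup\{\rho>0: Z_f(\varphi)\text{ can be meromorphically continued to a domain containing } \mathrm{Re}(s)>-\rho\},$$ $$m_0(f):=\inf\{m_0(f,\varphi):\varphi\in C_0^\infty(U)\}.$$ *)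

theory Defs
  imports "HOL-Complex_Analysis.Complex_Analysis"
begin

primrec k_times_cont_differentiable ::
    "nat \<Rightarrow> ('a::real_normed_vector \<Rightarrow> 'b::real_normed_vector) \<Rightarrow> bool" where
  "k_times_cont_differentiable 0 g \<longleftrightarrow> continuous_on UNIV g"
| "k_times_cont_differentiable (Suc k) g \<longleftrightarrow>
     (\<forall>x. g differentiable (at x)) \<and>
     (\<forall>v. k_times_cont_differentiable k (\<lambda>x. frechet_derivative g (at x) v))"

definition smooth :: "('a::real_normed_vector \<Rightarrow> 'b::real_normed_vector) \<Rightarrow> bool" where
  "smooth g \<longleftrightarrow> (\<forall>k. k_times_cont_differentiable k g)"

text \<open>Test functions on \<open>U\<close> are represented by their extension by zero to the whole plane.\<close>

definition test_functions :: "(real \<times> real) set \<Rightarrow> (real \<times> real \<Rightarrow> complex) set" where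
  "test_functions U =
     {\<phi>. smooth \<phi> \<and> compact (closure {z. \<phi> z \<noteq> 0}) \<and> closure {z. \<phi> z \<noteq> 0} \<subseteq> U}"

definition zeta_integrand ::
    "(real \<times> real \<Rightarrow> real) \<Rightarrow> (real \<times> real \<Rightarrow> complex) \<Rightarrow> complex \<Rightarrow> real \<times> real \<Rightarrow> complex" where
  "zeta_integrand f \<phi> s = (\<lambda>z. complex_of_real \<bar>f z\<bar> powr s * \<phi> z)"

definition local_zeta ::
    "(real \<times> real \<Rightarrow> real) \<Rightarrow> (real \<times> real \<Rightarrow> complex) \<Rightarrow> complex \<Rightarrow> complex" where
  "local_zeta f \<phi> s = integral\<^sup>L lborel (zeta_integrand f \<phi> s)"

definition right_half_plane :: "real \<Rightarrow> complex set" where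
  "right_half_plane c = {s. c < Re s}"

text \<open>\<open>F\<close>, given on \<open>A\<close>, has a meromorphic continuation to \<open>D\<close>. The relation
  \<open>meromorphic_on\<close> ignores the values at isolated points, so where \<open>F\<close> is holomorphic,
  requiring agreement at every point of \<open>A \<inter> D\<close> is no restriction.\<close>

definition meromorphically_continuable ::
    "(complex \<Rightarrow> complex) \<Rightarrow> complex set \<Rightarrow> complex set \<Rightarrow> bool" where
  "meromorphically_continuable F A D \<longleftrightarrow>
     (\<exists>g. g meromorphic_on D \<and> (\<forall>s \<in> A \<inter> D. g s = F s))"

text \<open>For continuous \<open>f\<close> the integral always converges on \<open>Re s > 0\<close>. Since \<open>D\<close> is connected
  and contains this half-plane, agreement there determines the continuation up to its values
  at isolated points. The supremum and infimum are
  taken in \<open>ereal\<close>, because the value is \<open>\<infinity>\<close> for instance when \<open>\<phi> = 0\<close>.\<close>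

definition m0_at :: "(real \<times> real \<Rightarrow> real) \<Rightarrow> (real \<times> real \<Rightarrow> complex) \<Rightarrow> ereal" where
  "m0_at f \<phi> = Sup {ereal \<rho> | \<rho>. \<rho> > 0 \<and>
     (\<exists>D. open D \<and> connected D \<and> right_half_plane (- \<rho>) \<subseteq> D \<and>
          meromorphically_continuable (local_zeta f \<phi>) (right_half_plane 0) D)}"

definition m0 :: "(real \<times> real) set \<Rightarrow> (real \<times> real \<Rightarrow> real) \<Rightarrow> ereal" where
  "m0 U f = (INF \<phi> \<in> test_functions U. m0_at f \<phi>)"

definition flat_exp :: "real \<Rightarrow> real \<Rightarrow> real" where
  "flat_exp p x = (if x = 0 then 0 else exp (- (1 / \<bar>x\<bar> powr p)))"

end

theory Submission
  imports Defs "HOL-Real_Asymp.Real_Asymp"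
begin

text \<open>
  Since \<open>q\<close> and \<open>q'\<close> are even, \<open>f\<close> is \<open>x^(a-q') y^(b-q)\<close> times a sum of three nonnegative
  functions, so \<open>\<bar>f\<bar>\<close> is the sum of the absolute values of its three terms (\<open>abs_f\<close>). In
  particular \<open>\<bar>f\<bar> \<ge> \<bar>x\<bar>^a \<bar>y\<bar>^b\<close>, and because \<open>a < b\<close> the zeta integral converges for
  \<open>Re s > -1/b\<close>. Near the origin \<open>\<bar>f\<bar> < 1\<close>, so with \<open>w = - ln \<bar>f\<bar> \<ge> 0\<close> the zeta function is the
  Laplace transform \<open>s \<mapsto> \<integral> exp(-s w) \<phi>\<close>. Expanding the exponential around real centres gives power
  series, hence holomorphy; for \<open>\<phi> \<ge> 0\<close> it is the transform of a positive measure.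

  Now let \<open>\<phi> \<ge> 0\<close> with \<open>\<phi>(0,0) > 0\<close>, and suppose that the zeta function continues meromorphically
  to a neighbourhood of \<open>-1/b\<close>. Neither a pole nor a removable singularity is possible there.

  \<^item> It is not a pole (\<open>zeta_residue_vanishes\<close>). On each vertical line \<open>x = const \<noteq> 0\<close> the term
    \<open>x^a y^(b-q) exp(-1/\<bar>x\<bar>^p)\<close> lowers the order of vanishing in \<open>y\<close>, so that the fibre integral stays
    bounded as \<open>s \<rightarrow> -1/b\<close>. On the other hand \<open>\<epsilon>\<close> times the fibre integral at \<open>-1/b + \<epsilon>\<close> is at most
    \<open>(2/b) \<bar>x\<bar>^(-a/b)\<close>, which is integrable. By dominated convergence \<open>\<epsilon> Z(-1/b + \<epsilon>) \<rightarrow> 0\<close>,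
    which is impossible at a pole of any order.

  \<^item> It is not removable either. By Landau's theorem for positive measures
    (\<open>landau_convergence\<close>) a holomorphic extension across \<open>-1/b\<close> would make \<open>\<integral> \<bar>f\<bar>^\<sigma> \<phi>\<close> finite for some
    \<open>\<sigma> < -1/b\<close>. That integral is infinite (\<open>integral_diverges\<close>): the flat terms matter only extremely close to
    the axes, and on boxes \<open>[t,2t] \<times> [d,2d]\<close> with \<open>d = exp(-k/t^p)\<close> one still has
    \<open>\<bar>f\<bar> \<le> 3 x^a y^b\<close>; the contribution of such a box is at least of order \<open>t^(a\<sigma>+1) d^(b\<sigma>+1)\<close>, where
    \<open>d^(b\<sigma>+1) = exp(k \<bar>b\<sigma>+1\<bar>/t^p)\<close> beats every power of \<open>t\<close>.

  For \<open>m0\<close>, every test function admits the half-plane \<open>Re s > -1/b\<close>. A smooth bump function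
  at the origin (\<open>ex_bump_function\<close>) admits no larger one, because by the identity theorem any
  continuation from \<open>Re s > 0\<close> agrees with the zeta function on \<open>Re s > -1/b\<close> close to \<open>-1/b\<close>.
\<close>

section \<open>Laplace transforms and Landau's theorem\<close>

definition laplace :: "'a measure \<Rightarrow> ('a \<Rightarrow> real) \<Rightarrow> ('a \<Rightarrow> complex) \<Rightarrow> complex \<Rightarrow> complex" where
  "laplace M w \<psi> s = (LINT x|M. exp (- s * of_real (w x)) * \<psi> x)"

locale laplace_convergent =
  fixes M :: "'a measure" and w :: "'a \<Rightarrow> real" and \<psi> :: "'a \<Rightarrow> complex" and \<sigma>\<^sub>0 :: real
  assumes measurable_w [measurable]: "w \<in> borel_measurable M"
    and measurable_\<psi> [measurable]: "\<psi> \<in> borel_measurable M"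
    and w_nonneg: "w x \<ge> 0"
    and convergent: "\<sigma> > \<sigma>\<^sub>0 \<Longrightarrow> integrable M (\<lambda>x. exp (- \<sigma> * w x) * norm (\<psi> x))"
begin

lemma integrable_laplace:
  assumes "\<sigma>\<^sub>0 < Re s"
  shows "integrable M (\<lambda>x. exp (- s * of_real (w x)) * \<psi> x)"
proof (rule Bochner_Integration.integrable_bound[OF convergent[OF assms]])
  show "AE x in M. norm (exp (- s * of_real (w x)) * \<psi> x)
          \<le> norm (exp (- Re s * w x) * norm (\<psi> x))"
    by (simp add: norm_mult)
qed measurable

text \<open>The Taylor coefficients of the transform at the real point \<open>c\<close>.\<close>

definition moment :: "real \<Rightarrow> nat \<Rightarrow> complex" where
  "moment c k = (LINT x|M. of_real ((- w x) ^ k / fact k * exp (- c * w x)) * \<psi> x)"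

text \<open>Termwise integration of \<open>exp(t w) = \<Sum>k. (t w)^k / k!\<close>. All terms are nonnegative, so monotone
  convergence applies and the sum of the integrals is the transform of \<open>norm \<psi>\<close> at the real point
  \<open>c - t\<close>. This is the majorant that justifies the complex expansion below.\<close>

lemma exp_series_dominated:
  assumes "0 \<le> t" "t < c - \<sigma>\<^sub>0"
  shows "integrable M (\<lambda>x. t ^ k * (w x ^ k / fact k * exp (- c * w x) * norm (\<psi> x)))"
    and "(\<lambda>k. LINT x|M. t ^ k * (w x ^ k / fact k * exp (- c * w x) * norm (\<psi> x))) sums
           (LINT x|M. exp (- (c - t) * w x) * norm (\<psi> x))"
proof -
  let ?u = "\<lambda>k x. t ^ k * (w x ^ k / fact k * exp (- c * w x) * norm (\<psi> x))"
  let ?U = "\<lambda>x. exp (- (c - t) * w x) * norm (\<psi> x)"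
  have nn: "?u k x \<ge> 0" for k x using assms(1) w_nonneg by simp
  have pt: "(\<lambda>k. ?u k x) sums ?U x" for x
  proof -
    have "(\<lambda>k. (t * w x) ^ k /\<^sub>R fact k) sums exp (t * w x)" by (rule exp_converges)
    from sums_mult[OF this, of "exp (- c * w x) * norm (\<psi> x)"]
    have "(\<lambda>k. exp (- c * w x) * norm (\<psi> x) * ((t * w x) ^ k /\<^sub>R fact k)) sums
        (exp (- c * w x) * norm (\<psi> x) * exp (t * w x))" .
    moreover have "exp (- c * w x) * norm (\<psi> x) * exp (t * w x) = ?U x"
      by (simp add: mult_exp_exp algebra_simps)
    moreover have "exp (- c * w x) * norm (\<psi> x) * ((t * w x) ^ k /\<^sub>R fact k) = ?u k x" for k
      by (simp add: power_mult_distrib field_simps)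
    ultimately show ?thesis by (simp only:)
  qed
  have iU: "integrable M ?U" using assms convergent[of "c - t"] by simp
  have le: "?u k x \<le> ?U x" for k x
    using sum_le_suminf[OF sums_summable[OF pt], of "{k}" x] nn
      sums_unique[OF pt] by simp
  show iu: "integrable M (?u k)" for k
  proof (rule Bochner_Integration.integrable_bound[OF iU])
    have "norm (?u k x) \<le> norm (?U x)" for x
      unfolding real_norm_def abs_of_nonneg[OF nn] using le by (rule order_trans) simp
    thus "AE x in M. norm (?u k x) \<le> norm (?U x)" by (rule AE_I2)
  qed measurable
  have "(\<Sum>k. ennreal (LINT x|M. ?u k x)) = (\<Sum>k. \<integral>\<^sup>+ x. ?u k x \<partial>M)"
    using nn by (intro suminf_cong nn_integral_eq_integral[symmetric] iu) auto
  also have "\<dots> = (\<integral>\<^sup>+ x. (\<Sum>k. ennreal (?u k x)) \<partial>M)"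
    by (rule nn_integral_suminf[symmetric]) measurable
  also have "\<dots> = (\<integral>\<^sup>+ x. ?U x \<partial>M)"
    using suminf_ennreal2[OF nn sums_summable[OF pt]] sums_unique[OF pt] by simp
  also have "\<dots> = ennreal (LINT x|M. ?U x)"
    by (rule nn_integral_eq_integral[OF iU]) auto
  finally have e: "(\<Sum>k. ennreal (LINT x|M. ?u k x)) = ennreal (LINT x|M. ?U x)" .
  have nni: "0 \<le> (LINT x|M. ?u k x)" for k using nn by (intro integral_nonneg_AE) auto
  have "summable (\<lambda>k. LINT x|M. ?u k x)"
    by (rule summable_suminf_not_top[OF nni]) (simp only: e ennreal_neq_top not_False_eq_True)
  moreover have "(\<Sum>k. LINT x|M. ?u k x) = (LINT x|M. ?U x)"
    if sm: "summable (\<lambda>k. LINT x|M. ?u k x)"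
  proof -
    have "0 \<le> (\<Sum>k. LINT x|M. ?u k x)" by (rule suminf_nonneg[OF sm nni])
    moreover have "0 \<le> (LINT x|M. ?U x)" by (rule integral_nonneg_AE) simp
    ultimately show ?thesis
      using e unfolding suminf_ennreal2[OF nni sm] by (simp only: ennreal_inj)
  qed
  ultimately show "(\<lambda>k. LINT x|M. ?u k x) sums (LINT x|M. ?U x)"
    by (simp add: sums_iff)
qed

text \<open>The radius of convergence at a real centre \<open>c\<close> is at least the distance to the abscissa,
  because \<open>\<bar>exp(-(s-c) w)\<bar>\<close> and all its Taylor sections are dominated by \<open>exp(\<bar>s-c\<bar> w)\<close>.\<close>

lemma laplace_power_series:
  assumes "cmod (s - of_real c) < c - \<sigma>\<^sub>0"
  shows "(\<lambda>k. moment c k * (s - of_real c) ^ k) sums laplace M w \<psi> s"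
proof -
  define z where "z = s - of_real c"
  let ?v = "\<lambda>k x. z ^ k * (of_real ((- w x) ^ k / fact k * exp (- c * w x)) * \<psi> x)"
  have dom: "0 \<le> norm z" "norm z < c - \<sigma>\<^sub>0" using assms by (auto simp: z_def)
  have nv: "norm (?v k x) = norm z ^ k * (w x ^ k / fact k * exp (- c * w x) * norm (\<psi> x))" for k x
    using w_nonneg[of x] by (simp add: norm_mult norm_power norm_divide)
  have pt: "(\<lambda>k. ?v k x) sums (exp (- s * of_real (w x)) * \<psi> x)" for x
  proof -
    have "(\<lambda>k. (- z * of_real (w x)) ^ k /\<^sub>R fact k) sums exp (- z * of_real (w x))"
      by (rule exp_converges)
    from sums_mult[OF this, of "of_real (exp (- c * w x)) * \<psi> x"]
    have "(\<lambda>k. of_real (exp (- c * w x)) * \<psi> x * ((- z * of_real (w x)) ^ k /\<^sub>R fact k)) sums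
        (of_real (exp (- c * w x)) * \<psi> x * exp (- z * of_real (w x)))" .
    moreover have "of_real (exp (- c * w x)) * \<psi> x * exp (- z * of_real (w x))
        = exp (- s * of_real (w x)) * \<psi> x"
      unfolding z_def exp_of_real[symmetric] by (simp add: exp_add[symmetric] algebra_simps)
    moreover have "of_real (exp (- c * w x)) * \<psi> x * ((- z * of_real (w x)) ^ k /\<^sub>R fact k) = ?v k x" for k
      by (simp add: power_mult_distrib power_minus[of "_ * _"] power_minus[of "of_real _"] power_minus[of "w x"] field_simps scaleR_conv_of_real)
    ultimately show ?thesis by (simp only:)
  qed
  have iv: "integrable M (?v k)" for k
  proof (rule integrable_norm_cancel)
    show "integrable M (\<lambda>x. norm (?v k x))"
      unfolding nv by (rule exp_series_dominated(1)[OF dom])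
  qed measurable
  have "(\<lambda>k. LINT x|M. ?v k x) sums (LINT x|M. (\<Sum>k. ?v k x))"
  proof (rule sums_integral[OF iv])
    show "AE x in M. summable (\<lambda>k. norm (?v k x))"
    proof (rule AE_I2)
      fix x
      have "(\<lambda>k. (norm z * w x) ^ k /\<^sub>R fact k) sums exp (norm z * w x)" by (rule exp_converges)
      from sums_summable[OF sums_mult[OF this, of "exp (- c * w x) * norm (\<psi> x)"]]
      show "summable (\<lambda>k. norm (?v k x))"
        unfolding nv by (simp add: power_mult_distrib field_simps scaleR_conv_of_real)
    qed
    show "summable (\<lambda>k. LINT x|M. norm (?v k x))"
      unfolding nv by (rule sums_summable[OF exp_series_dominated(2)[OF dom]])
  qed
  moreover have "(LINT x|M. (\<Sum>k. ?v k x)) = laplace M w \<psi> s"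
    using sums_unique[OF pt] by (simp add: laplace_def)
  moreover have "(LINT x|M. ?v k x) = moment c k * z ^ k" for k
    by (simp add: moment_def)
  ultimately show ?thesis by (simp add: z_def)
qed

text \<open>Real centres suffice: the discs around \<open>c\<close> of radius \<open>c - \<sigma>\<^sub>0\<close> exhaust the half-plane as
  \<open>c \<rightarrow> \<infinity>\<close>.\<close>

lemma holomorphic_laplace: "laplace M w \<psi> holomorphic_on right_half_plane \<sigma>\<^sub>0"
proof -
  have "laplace M w \<psi> holomorphic_on (\<Union>c. ball (complex_of_real c) (c - \<sigma>\<^sub>0))"
    using laplace_power_series
    by (intro holomorphic_on_UN_open power_series_holomorphic open_ball)
       (auto simp: dist_norm norm_minus_commute)
  moreover have "s \<in> (\<Union>c. ball (complex_of_real c) (c - \<sigma>\<^sub>0))" if "\<sigma>\<^sub>0 < Re s" for s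
  proof -
    define d where "d = Re s - \<sigma>\<^sub>0"
    have d: "d > 0" using that by (simp add: d_def)
    \<comment> \<open>\<open>s\<close> lies in the disc of \<open>c\<close> as soon as \<open>2 d (c - \<sigma>\<^sub>0) > d\<^sup>2 + (Im s)\<^sup>2\<close>.\<close>
    define c where "c = \<sigma>\<^sub>0 + d + (Im s)\<^sup>2 / d"
    have "(cmod (of_real c - s))\<^sup>2 = ((Im s)\<^sup>2 / d)\<^sup>2 + (Im s)\<^sup>2"
      by (simp add: cmod_def c_def d_def)
    also have "\<dots> < (d + (Im s)\<^sup>2 / d)\<^sup>2"
      using d by (simp add: power2_eq_square field_simps)
         (simp add: add_pos_nonneg)
    finally have "cmod (of_real c - s) < d + (Im s)\<^sup>2 / d"
      by (rule power2_less_imp_less) (use d in simp)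
    hence "s \<in> ball (complex_of_real c) (c - \<sigma>\<^sub>0)"
      by (simp add: c_def dist_norm)
    thus ?thesis by blast
  qed
  ultimately show ?thesis
    by (elim holomorphic_on_subset) (auto simp: right_half_plane_def)
qed

end

text \<open>Landau's theorem, in the form that a holomorphic extension across the abscissa of a positive
  transform forces convergence further left. Expand around \<open>c = \<sigma>\<^sub>0 + R\<close>, inside the half-plane of
  convergence. The Taylor series of \<open>h\<close> converges on the disc of radius \<open>2 R\<close>, and its coefficients are the
  moments, which have sign \<open>(-1)^k\<close>. At a point \<open>\<tau> = c - t\<close> these signs cancel those of \<open>(-t)^k\<close>, so the
  series has nonnegative terms, and Tonelli's theorem turns its finite sum back into the integral
  at \<open>\<tau>\<close>.\<close>

lemma landau_convergence:
  assumes conv: "laplace_convergent M w (\<lambda>x. of_real (\<psi> x)) \<sigma>\<^sub>0"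
    and nn: "\<And>x. \<psi> x \<ge> 0"
    and R: "R > 0"
    and holo: "h holomorphic_on ball (of_real (\<sigma>\<^sub>0 + R)) (2 * R)"
    and eq: "\<And>s. s \<in> ball (of_real (\<sigma>\<^sub>0 + R)) R \<Longrightarrow> h s = laplace M w (\<lambda>x. of_real (\<psi> x)) s"
    and \<tau>: "\<sigma>\<^sub>0 - R < \<tau>" "\<tau> \<le> \<sigma>\<^sub>0 + R"
  shows "(\<integral>\<^sup>+ x. exp (- \<tau> * w x) * \<psi> x \<partial>M) < \<infinity>"
proof -
  interpret laplace_convergent M w "\<lambda>x. of_real (\<psi> x)" \<sigma>\<^sub>0 by (rule conv)
  have [measurable]: "\<psi> \<in> borel_measurable M"
    using measurable_compose[OF measurable_\<psi> borel_measurable_Re] by simp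
  define c where "c = \<sigma>\<^sub>0 + R"
  define t where "t = c - \<tau>"
  have t: "0 \<le> t" "t < 2 * R" using \<tau> by (auto simp: t_def c_def)
  define A where "A k = (deriv ^^ k) h (of_real c) / fact k" for k
  have hA: "(\<lambda>k. A k * (s - of_real c) ^ k) sums h s" if "s \<in> ball (of_real c) (2 * R)" for s
    unfolding A_def by (rule holomorphic_power_series[OF holo[folded c_def] that])
  have hm: "(\<lambda>k. moment c k * (s - of_real c) ^ k) sums h s" if "s \<in> ball (of_real c) R" for s
    using laplace_power_series[of s c] that eq by (simp add: c_def dist_norm norm_minus_commute)
  have e1: "(\<lambda>z. h (of_real c + z)) has_fps_expansion Abs_fps A"
  proof (rule has_fps_expansionI)
    show "\<forall>\<^sub>F u in nhds 0. (\<lambda>n. fps_nth (Abs_fps A) n * u ^ n) sums h (of_real c + u)"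
      using eventually_nhds_in_open[of "ball 0 (2 * R)" "0::complex"] R hA[of "of_real c + _"]
      by (auto elim!: eventually_mono simp: dist_norm)
  qed
  have e2: "(\<lambda>z. h (of_real c + z)) has_fps_expansion Abs_fps (moment c)"
  proof (rule has_fps_expansionI)
    show "\<forall>\<^sub>F u in nhds 0. (\<lambda>n. fps_nth (Abs_fps (moment c)) n * u ^ n) sums h (of_real c + u)"
      using eventually_nhds_in_open[of "ball 0 R" "0::complex"] R hm[of "of_real c + _"]
      by (auto elim!: eventually_mono simp: dist_norm)
  qed
  have A: "A k = moment c k" for k
    using fps_expansion_unique_complex[OF e1 e2] by (simp add: fps_eq_iff)
  let ?u = "\<lambda>k x. w x ^ k / fact k * exp (- c * w x) * \<psi> x"
  have iu: "integrable M (?u k)" for k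
  proof -
    have "integrable M (\<lambda>x. (R/2) ^ k * (?u k x))"
      using exp_series_dominated(1)[of "R/2" c k] R nn by (simp add: c_def abs_of_nonneg)
    thus ?thesis using R by (subst (asm) integrable_mult_left_iff) auto
  qed
  have m: "moment c k = (-1) ^ k * of_real (LINT x|M. ?u k x)" for k
  proof -
    have "of_real ((- w x) ^ k / fact k * exp (- c * w x)) * complex_of_real (\<psi> x)
        = (-1) ^ k * of_real (?u k x)" for x by (simp add: power_minus[of "w x"] power_minus[of "of_real (w x)"])
    thus ?thesis unfolding moment_def by (simp del: of_real_mult of_real_divide)
  qed
  have "(\<lambda>k. A k * (of_real (- t)) ^ k) sums h (of_real (c - t))"
    using hA[of "of_real (c - t)"] t by (simp add: dist_norm)
  moreover have "A k * of_real (- t) ^ k = of_real (t ^ k * (LINT x|M. ?u k x))" for k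
    unfolding A m by (cases "even k") simp_all
  ultimately have "(\<lambda>k. complex_of_real (t ^ k * (LINT x|M. ?u k x))) sums h (of_real (c - t))"
    by (simp only:)
  from summable_Re[OF sums_summable[OF this]]
  have s: "summable (\<lambda>k. t ^ k * (LINT x|M. ?u k x))"
    by (simp only: Re_complex_of_real)
  have nu: "?u k x \<ge> 0" for k x using nn w_nonneg by simp
  have pt: "(\<lambda>k. t ^ k * ?u k x) sums (exp (- \<tau> * w x) * \<psi> x)" for x
  proof -
    have "(\<lambda>k. (t * w x) ^ k /\<^sub>R fact k) sums exp (t * w x)" by (rule exp_converges)
    from sums_mult[OF this, of "exp (- c * w x) * \<psi> x"]
    have "(\<lambda>k. exp (- c * w x) * \<psi> x * ((t * w x) ^ k /\<^sub>R fact k)) sums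
        (exp (- c * w x) * \<psi> x * exp (t * w x))" .
    moreover have "exp (- c * w x) * \<psi> x * exp (t * w x) = exp (- \<tau> * w x) * \<psi> x"
      unfolding t_def by (simp add: mult_exp_exp algebra_simps)
    moreover have "exp (- c * w x) * \<psi> x * ((t * w x) ^ k /\<^sub>R fact k) = t ^ k * ?u k x" for k
      by (simp add: power_mult_distrib field_simps)
    ultimately show ?thesis by (simp only:)
  qed
  have nt: "0 \<le> t ^ k * ?u k x" for k x using nu t by (intro mult_nonneg_nonneg[OF _ nu]) simp
  have "(\<integral>\<^sup>+ x. exp (- \<tau> * w x) * \<psi> x \<partial>M) = (\<integral>\<^sup>+ x. (\<Sum>k. ennreal (t ^ k * ?u k x)) \<partial>M)"
    using suminf_ennreal2[OF nt sums_summable[OF pt]] sums_unique[OF pt] by simp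
  also have "\<dots> = (\<Sum>k. \<integral>\<^sup>+ x. t ^ k * ?u k x \<partial>M)"
    by (rule nn_integral_suminf) measurable
  also have "\<dots> = (\<Sum>k. ennreal (t ^ k * (LINT x|M. ?u k x)))"
  proof (intro suminf_cong)
    fix k show "(\<integral>\<^sup>+ x. t ^ k * ?u k x \<partial>M) = ennreal (t ^ k * (LINT x|M. ?u k x))"
      using nn_integral_eq_integral[OF integrable_mult_right[OF iu] AE_I2[OF nt]]
      by (simp only: integral_mult_right_zero)
  qed
  also have "\<dots> < \<infinity>"
  proof -
    have "0 \<le> t ^ k * (LINT x|M. ?u k x)" for k
      using t by (intro mult_nonneg_nonneg integral_nonneg_AE AE_I2 nu) simp
    from suminf_ennreal2[OF this s] show ?thesis by (simp only: ennreal_less_top infinity_ennreal_def)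
  qed
  finally show ?thesis .
qed

section \<open>Elementary integrals and the flat exponential\<close>

lemma nn_integral_plane:
  fixes F :: "real \<times> real \<Rightarrow> ennreal"
  assumes "F \<in> borel_measurable borel"
  shows "(\<integral>\<^sup>+ z. F z \<partial>lborel) = (\<integral>\<^sup>+ x. \<integral>\<^sup>+ y. F (x, y) \<partial>lborel \<partial>lborel)"
  using lborel.nn_integral_fst[of F lborel] assms by (simp add: lborel_prod)

lemma nn_integral_abs_powr:
  fixes \<beta> :: real
  assumes "\<beta> > -1"
  shows "(\<integral>\<^sup>+ x. ennreal (\<bar>x\<bar> powr \<beta> * indicator {-1/2..1/2} x) \<partial>lborel)
           = ennreal (2 * (1/2) powr (\<beta> + 1) / (\<beta> + 1))"
proof -
  let ?I = "(1/2) powr (\<beta> + 1) / (\<beta> + 1)"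
  have 1: "((\<lambda>x. \<bar>x\<bar> powr \<beta>) has_integral ?I) {0..1/2}"
    by (rule has_integral_eq[OF _ has_integral_powr_from_0[OF assms]]) auto
  have 2: "((\<lambda>x. \<bar>x\<bar> powr \<beta>) has_integral ?I) {-1/2..0}"
    using 1 has_integral_reflect_real[where f = "\<lambda>x. \<bar>x\<bar> powr \<beta>" and a = 0 and b = "1/2"] by simp
  have "((\<lambda>x. \<bar>x\<bar> powr \<beta>) has_integral (?I + ?I)) {-1/2..1/2}"
    by (rule has_integral_combine[OF _ _ 2 1]) auto
  hence "((\<lambda>x. if x \<in> {-1/2..1/2} then \<bar>x\<bar> powr \<beta> else 0) has_integral (?I + ?I)) UNIV"
    by (subst has_integral_restrict_UNIV)
  also have "(\<lambda>x. if x \<in> {-1/2..1/2} then \<bar>x\<bar> powr \<beta> else 0)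
      = (\<lambda>x. \<bar>x\<bar> powr \<beta> * indicator {-1/2..1/2} x)" by auto
  finally have "integral\<^sup>N lborel (\<lambda>x. ennreal (\<bar>x\<bar> powr \<beta> * indicator {-1/2..1/2} x)) = ennreal (?I + ?I)"
    by (intro nn_integral_has_integral_lborel) auto
  thus ?thesis by (simp add: add_divide_distrib[symmetric])
qed

lemma flat_exp_nonneg: "flat_exp p x \<ge> 0" and flat_exp_le_1: "flat_exp p x \<le> 1"
  and flat_exp_pos: "x \<noteq> 0 \<Longrightarrow> flat_exp p x > 0"
  by (auto simp: flat_exp_def)

lemma flat_exp_mono:
  assumes "p > 0" "0 < x" "x \<le> y"
  shows "flat_exp p x \<le> flat_exp p y"
  using assms by (auto simp: flat_exp_def intro!: divide_left_mono powr_mono2)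

lemma borel_measurable_flat_exp [measurable]: "flat_exp p \<in> borel_measurable borel"
  unfolding flat_exp_def[abs_def] by measurable

section \<open>Size estimates for \<open>f\<close>\<close>

locale flat_perturbation =
  fixes a b q q' :: nat and p p' :: real
  assumes a: "2 \<le> a" and ab: "a < b" and p: "p > 0" and p': "p' > 0"
    and q: "even q" "2 \<le> q" "q \<le> b" and q': "even q'" "2 \<le> q'" "q' \<le> a"
begin

definition f :: "real \<times> real \<Rightarrow> real" where
  "f = (\<lambda>(x, y). x ^ a * y ^ b + x ^ a * y ^ (b - q) * flat_exp p x
                              + x ^ (a - q') * y ^ b * flat_exp p' y)"

lemma borel_measurable_f [measurable]: "f \<in> borel_measurable borel"
  unfolding f_def borel_prod[symmetric] by measurable

text \<open>This is where the parity of \<open>q\<close> and \<open>q'\<close> enters: the cofactor \<open>?N\<close> below is nonnegative, so no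
  cancellation can occur between the three terms.\<close>

lemma abs_f:
  "\<bar>f (x, y)\<bar> = \<bar>x\<bar> ^ a * \<bar>y\<bar> ^ b + \<bar>x\<bar> ^ a * \<bar>y\<bar> ^ (b - q) * flat_exp p x
                 + \<bar>x\<bar> ^ (a - q') * \<bar>y\<bar> ^ b * flat_exp p' y"
proof -
  have ea: "u ^ a = u ^ (a - q') * u ^ q'" and eb: "u ^ b = u ^ (b - q) * u ^ q" for u :: real
    using q q' by (simp_all add: power_add[symmetric])
  let ?N = "x ^ q' * y ^ q + x ^ q' * flat_exp p x + y ^ q * flat_exp p' y"
  have N: "?N \<ge> 0"
    using q q' by (intro add_nonneg_nonneg mult_nonneg_nonneg zero_le_even_power flat_exp_nonneg) auto
  have "f (x, y) = x ^ (a - q') * y ^ (b - q) * ?N"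
    unfolding f_def case_prod_conv ea eb by algebra
  hence "\<bar>f (x, y)\<bar> = \<bar>x\<bar> ^ (a - q') * \<bar>y\<bar> ^ (b - q) * ?N"
    using N by (simp add: abs_mult power_abs)
  also have "?N = \<bar>x\<bar> ^ q' * \<bar>y\<bar> ^ q + \<bar>x\<bar> ^ q' * flat_exp p x + \<bar>y\<bar> ^ q * flat_exp p' y"
    using q q' by (simp add: power_even_abs)
  also have "\<bar>x\<bar> ^ (a - q') * \<bar>y\<bar> ^ (b - q) * \<dots> =
      \<bar>x\<bar> ^ a * \<bar>y\<bar> ^ b + \<bar>x\<bar> ^ a * \<bar>y\<bar> ^ (b - q) * flat_exp p x
                 + \<bar>x\<bar> ^ (a - q') * \<bar>y\<bar> ^ b * flat_exp p' y"
    unfolding ea[of "\<bar>x\<bar>"] eb[of "\<bar>y\<bar>"] by algebra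
  finally show ?thesis .
qed

lemma abs_f_ge:
  shows "\<bar>x\<bar> ^ a * \<bar>y\<bar> ^ b \<le> \<bar>f (x, y)\<bar>"
    and "\<bar>x\<bar> ^ a * flat_exp p x * \<bar>y\<bar> ^ (b - q) \<le> \<bar>f (x, y)\<bar>"
  unfolding abs_f by (simp_all add: flat_exp_nonneg mult_ac)

lemma f_nonzero: "x \<noteq> 0 \<Longrightarrow> y \<noteq> 0 \<Longrightarrow> f (x, y) \<noteq> 0"
proof -
  assume "x \<noteq> 0" "y \<noteq> 0"
  hence "0 < \<bar>x\<bar> ^ a * \<bar>y\<bar> ^ b" by simp
  thus ?thesis using abs_f_ge(1)[of x y] by linarith
qed

lemma abs_f_less_1:
  assumes "\<bar>x\<bar> \<le> 1/2" "\<bar>y\<bar> \<le> 1/2"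
  shows "\<bar>f (x, y)\<bar> < 1"
proof -
  have pw: "u ^ n \<le> (1/4::real)" if "0 \<le> u" "u \<le> 1/2" "2 \<le> n" for u n
  proof -
    have "u ^ n \<le> u ^ 2" using that by (intro power_decreasing) auto
    also have "\<dots> \<le> (1/2) ^ 2" using that by (intro power_mono) auto
    finally show ?thesis by (simp add: power2_eq_square)
  qed
  have le1: "\<bar>x\<bar> ^ n \<le> 1" "\<bar>y\<bar> ^ n \<le> 1" for n using assms by (auto intro!: power_le_one)
  have xa: "\<bar>x\<bar> ^ a \<le> 1/4" and yb: "\<bar>y\<bar> ^ b \<le> 1/4" using assms a ab by (intro pw; simp)+
  have "\<bar>x\<bar> ^ a * \<bar>y\<bar> ^ b \<le> 1/4 * 1" by (intro mult_mono xa le1) auto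
  moreover have "\<bar>x\<bar> ^ a * \<bar>y\<bar> ^ (b - q) * flat_exp p x \<le> 1/4 * 1 * 1"
    by (intro mult_mono xa le1 flat_exp_le_1 flat_exp_nonneg) auto
  moreover have "\<bar>x\<bar> ^ (a - q') * \<bar>y\<bar> ^ b * flat_exp p' y \<le> 1 * (1/4) * 1"
    by (intro mult_mono yb le1 flat_exp_le_1 flat_exp_nonneg) auto
  ultimately show ?thesis unfolding abs_f by linarith
qed

abbreviation "I \<equiv> {-1/2..1/2::real}"

text \<open>The two complementary upper bounds on \<open>\<bar>f\<bar>^\<sigma>\<close> for \<open>\<sigma> \<le> 0\<close>. The monomial bound has an integrable
  factor in \<open>x\<close> but fails to be integrable in \<open>y\<close> at \<open>\<sigma> = -1/b\<close>; the bound through the flat term has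
  exponent \<open>-(b-q)/b > -1\<close> in \<open>y\<close> uniformly up to \<open>\<sigma> = -1/b\<close>, at the price of a factor that explodes as
  \<open>x \<rightarrow> 0\<close>.\<close>

lemma powr_f_le_monomial:
  fixes x y \<sigma> :: real
  assumes "x \<noteq> 0" "y \<noteq> 0" "\<sigma> \<le> 0"
  shows "\<bar>f (x, y)\<bar> powr \<sigma> \<le> \<bar>x\<bar> powr (a * \<sigma>) * \<bar>y\<bar> powr (b * \<sigma>)"
proof -
  have "\<bar>f (x, y)\<bar> powr \<sigma> \<le> (\<bar>x\<bar> ^ a * \<bar>y\<bar> ^ b) powr \<sigma>"
    using abs_f_ge(1) assms by (intro powr_mono2') auto
  also have "\<dots> = \<bar>x\<bar> powr (a * \<sigma>) * \<bar>y\<bar> powr (b * \<sigma>)"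
    using assms by (simp add: powr_mult powr_powr flip: powr_realpow)
  finally show ?thesis .
qed

lemma powr_f_le_flat:
  assumes "x \<noteq> 0" "y \<noteq> 0" "\<bar>x\<bar> \<le> 1" "\<bar>y\<bar> \<le> 1" "- (1/b) \<le> \<sigma>" "\<sigma> \<le> 0"
  shows "\<bar>f (x, y)\<bar> powr \<sigma> \<le>
           (\<bar>x\<bar> ^ a * flat_exp p x) powr (- (1/b)) * \<bar>y\<bar> powr (- (real (b - q) / b))"
proof -
  let ?A = "\<bar>x\<bar> ^ a * flat_exp p x"
  have A: "0 < ?A" "?A \<le> 1"
    using assms flat_exp_pos[of x p] flat_exp_le_1[of p x]
    by (auto intro!: mult_le_one power_le_one simp: flat_exp_nonneg)
  have Y: "0 < \<bar>y\<bar> ^ (b - q)" "\<bar>y\<bar> ^ (b - q) \<le> 1" using assms by (auto intro!: power_le_one)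
  have "\<bar>f (x, y)\<bar> powr \<sigma> \<le> (?A * \<bar>y\<bar> ^ (b - q)) powr \<sigma>"
    using abs_f_ge(2) assms A Y by (intro powr_mono2') auto
  also have "\<dots> = ?A powr \<sigma> * (\<bar>y\<bar> ^ (b - q)) powr \<sigma>"
    using A Y by (simp add: powr_mult)
  also have "\<dots> \<le> ?A powr (- (1/b)) * (\<bar>y\<bar> ^ (b - q)) powr (- (1/b))"
    using A Y assms by (intro mult_mono powr_mono') auto
  also have "(\<bar>y\<bar> ^ (b - q)) powr (- (1/b)) = \<bar>y\<bar> powr (- (real (b - q) / b))"
    using assms by (simp add: powr_powr flip: powr_realpow)
  finally show ?thesis .
qed

section \<open>Integrals along vertical lines\<close>

definition fibre_integral :: "real \<Rightarrow> real \<Rightarrow> ennreal" where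
  "fibre_integral \<sigma> x = (\<integral>\<^sup>+ y. ennreal (\<bar>f (x, y)\<bar> powr \<sigma> * indicator I y) \<partial>lborel)"

lemma fibre_integral_le_monomial:
  fixes x \<sigma> :: real
  assumes "x \<noteq> 0" "- (1/b) < \<sigma>" "\<sigma> \<le> 0"
  shows "fibre_integral \<sigma> x \<le> ennreal (\<bar>x\<bar> powr (a * \<sigma>) * (2 / (b * \<sigma> + 1)))"
proof -
  have b: "real b > 0" using ab by simp
  have b\<sigma>: "b * \<sigma> > -1" using assms(2) b by (simp add: field_simps)
  have "fibre_integral \<sigma> x \<le>
      (\<integral>\<^sup>+ y. ennreal (\<bar>x\<bar> powr (a * \<sigma>)) * ennreal (\<bar>y\<bar> powr (b * \<sigma>) * indicator I y) \<partial>lborel)"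
    \<comment> \<open>The point \<open>y = 0\<close> is excluded because \<open>0 powr \<sigma> = 0\<close> even for negative \<open>\<sigma>\<close>.\<close>
    unfolding fibre_integral_def
  proof (rule nn_integral_mono_AE)
    show "AE y in lborel. ennreal (\<bar>f (x, y)\<bar> powr \<sigma> * indicator I y)
       \<le> ennreal (\<bar>x\<bar> powr (a * \<sigma>)) * ennreal (\<bar>y\<bar> powr (b * \<sigma>) * indicator I y)"
      using AE_lborel_singleton[of 0]
    proof eventually_elim
      case (elim y)
      thus ?case using powr_f_le_monomial[of x y \<sigma>] assms
        by (auto simp: ennreal_mult[symmetric] indicator_def intro!: ennreal_leI)
    qed
  qed
  also have "\<dots> = ennreal (\<bar>x\<bar> powr (a * \<sigma>)) * ennreal (2 * (1/2) powr (b * \<sigma> + 1) / (b * \<sigma> + 1))"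
    by (subst nn_integral_cmult) (use nn_integral_abs_powr[OF b\<sigma>] in auto)
  also have "\<dots> = ennreal (\<bar>x\<bar> powr (a * \<sigma>) * (2 * (1/2) powr (b * \<sigma> + 1) / (b * \<sigma> + 1)))"
    using b\<sigma> by (intro ennreal_mult[symmetric]) auto
  also have "\<dots> \<le> ennreal (\<bar>x\<bar> powr (a * \<sigma>) * (2 / (b * \<sigma> + 1)))"
  proof (intro ennreal_leI mult_left_mono divide_right_mono)
    have "(1/2) powr (b * \<sigma> + 1) \<le> (1/2::real) powr 0" using b\<sigma> by (intro powr_mono') auto
    thus "2 * (1/2) powr (b * \<sigma> + 1) \<le> (2::real)" by simp
  qed (use b\<sigma> in auto)
  finally show ?thesis .
qed

lemma fibre_integral_le_flat:
  assumes "x \<noteq> 0" "x \<in> I"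
  shows "\<exists>K. \<forall>\<sigma>. - (1/b) \<le> \<sigma> \<and> \<sigma> \<le> 0 \<longrightarrow> fibre_integral \<sigma> x \<le> ennreal K"
proof -
  have b: "real b > 0" using ab by simp
  define \<gamma> where "\<gamma> = - (real (b - q) / b)"
  define A where "A = (\<bar>x\<bar> ^ a * flat_exp p x) powr (- (1/b))"
  have \<gamma>: "\<gamma> > -1" using q b by (simp add: \<gamma>_def field_simps)
  have "fibre_integral \<sigma> x \<le> ennreal (A * (2 * (1/2) powr (\<gamma> + 1) / (\<gamma> + 1)))"
    if \<sigma>: "- (1/b) \<le> \<sigma>" "\<sigma> \<le> 0" for \<sigma>
  proof -
    have "fibre_integral \<sigma> x \<le>
        (\<integral>\<^sup>+ y. ennreal A * ennreal (\<bar>y\<bar> powr \<gamma> * indicator I y) \<partial>lborel)"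
      unfolding fibre_integral_def
    proof (rule nn_integral_mono_AE)
      show "AE y in lborel. ennreal (\<bar>f (x, y)\<bar> powr \<sigma> * indicator I y)
         \<le> ennreal A * ennreal (\<bar>y\<bar> powr \<gamma> * indicator I y)"
        using AE_lborel_singleton[of 0]
      proof eventually_elim
        case (elim y)
        thus ?case using powr_f_le_flat[of x y \<sigma>] assms \<sigma>
          by (cases "y \<in> I") (auto simp: ennreal_mult[symmetric] A_def \<gamma>_def intro!: ennreal_leI)
      qed
    qed
    also have "\<dots> = ennreal A * ennreal (2 * (1/2) powr (\<gamma> + 1) / (\<gamma> + 1))"
      by (subst nn_integral_cmult) (use nn_integral_abs_powr[OF \<gamma>] in auto)
    also have "\<dots> = ennreal (A * (2 * (1/2) powr (\<gamma> + 1) / (\<gamma> + 1)))"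
      using \<gamma> by (intro ennreal_mult[symmetric]) (auto simp: A_def)
    finally show ?thesis .
  qed
  thus ?thesis by blast
qed

definition local_power :: "real \<Rightarrow> real \<times> real \<Rightarrow> real" where
  "local_power \<sigma> z = \<bar>f z\<bar> powr \<sigma> * indicator (I \<times> I) z"

lemma borel_measurable_local_power [measurable]: "local_power \<sigma> \<in> borel_measurable borel"
proof -
  have [measurable]: "I \<times> I \<in> sets borel" by (intro borel_closed closed_Times closed_atLeastAtMost)
  show ?thesis unfolding local_power_def[abs_def] by measurable
qed

lemma borel_measurable_fibre_integral [measurable]: "fibre_integral \<sigma> \<in> borel_measurable borel"
proof -
  have [measurable]: "f \<in> borel_measurable (borel \<Otimes>\<^sub>M borel)" by (simp add: borel_prod)
  show ?thesis unfolding fibre_integral_def[abs_def] by measurable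
qed

lemma nn_integral_local_power:
  "(\<integral>\<^sup>+ z. local_power \<sigma> z \<partial>lborel) = (\<integral>\<^sup>+ x. indicator I x * fibre_integral \<sigma> x \<partial>lborel)"
proof -
  have [measurable]: "f \<in> borel_measurable (borel \<Otimes>\<^sub>M borel)" by (simp add: borel_prod)
  have "(\<integral>\<^sup>+ z. local_power \<sigma> z \<partial>lborel) = (\<integral>\<^sup>+ x. \<integral>\<^sup>+ y. local_power \<sigma> (x, y) \<partial>lborel \<partial>lborel)"
    by (rule nn_integral_plane) measurable
  also have "\<dots> = (\<integral>\<^sup>+ x. \<integral>\<^sup>+ y. indicator I x * ennreal (\<bar>f (x, y)\<bar> powr \<sigma> * indicator I y) \<partial>lborel \<partial>lborel)"
    by (intro nn_integral_cong) (auto simp: local_power_def indicator_def)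
  also have "\<dots> = (\<integral>\<^sup>+ x. indicator I x * fibre_integral \<sigma> x \<partial>lborel)"
    unfolding fibre_integral_def by (intro nn_integral_cong nn_integral_cmult) measurable
  finally show ?thesis .
qed

text \<open>For \<open>\<sigma> \<ge> 0\<close> the power is bounded by its value at a smaller exponent since \<open>\<bar>f\<bar> < 1\<close>; for
  negative \<open>\<sigma>\<close> the monomial bound is integrable in both variables because \<open>a < b\<close>.\<close>

lemma local_power_integral_finite:
  assumes "- (1/b) < \<sigma>"
  shows "(\<integral>\<^sup>+ z. local_power \<sigma> z \<partial>lborel) < \<infinity>"
proof -
  have b: "real b > 0" using ab by simp
  define \<tau> where "\<tau> = min \<sigma> 0"
  have \<tau>: "- (1/b) < \<tau>" "\<tau> \<le> 0" "\<tau> \<le> \<sigma>" using assms b by (auto simp: \<tau>_def)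
  have b\<tau>: "b * \<tau> > -1" using \<tau>(1) b by (simp add: field_simps)
  have "b * \<tau> \<le> a * \<tau>" using \<tau>(2) ab by (intro mult_right_mono_neg) auto
  hence a\<tau>: "a * \<tau> > -1" using b\<tau> by linarith
  have "(\<integral>\<^sup>+ z. local_power \<sigma> z \<partial>lborel) \<le> (\<integral>\<^sup>+ z. local_power \<tau> z \<partial>lborel)"
  proof (intro nn_integral_mono ennreal_leI)
    fix z :: "real \<times> real"
    obtain x y where z: "z = (x, y)" by (cases z)
    have "\<bar>f z\<bar> powr \<sigma> \<le> \<bar>f z\<bar> powr \<tau>" if "z \<in> I \<times> I"
    proof -
      have "\<bar>f z\<bar> < 1" unfolding z by (rule abs_f_less_1) (use that in \<open>auto simp: z abs_le_iff\<close>)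
      thus ?thesis using \<tau> by (intro powr_mono') auto
    qed
    thus "local_power \<sigma> z \<le> local_power \<tau> z" by (auto simp: local_power_def indicator_def)
  qed
  also have "\<dots> = (\<integral>\<^sup>+ x. indicator I x * fibre_integral \<tau> x \<partial>lborel)"
    by (rule nn_integral_local_power)
  also have "\<dots> \<le> (\<integral>\<^sup>+ x. ennreal (2 / (b * \<tau> + 1)) * ennreal (\<bar>x\<bar> powr (a * \<tau>) * indicator I x) \<partial>lborel)"
  proof (rule nn_integral_mono_AE)
    show "AE x in lborel. indicator I x * fibre_integral \<tau> x
        \<le> ennreal (2 / (b * \<tau> + 1)) * ennreal (\<bar>x\<bar> powr (a * \<tau>) * indicator I x)"
      using AE_lborel_singleton[of 0]
    proof eventually_elim
      case (elim x)
      thus ?case using fibre_integral_le_monomial[OF elim \<tau>(1,2)] b\<tau>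
        by (cases "x \<in> I") (auto simp: ennreal_mult[symmetric] mult.commute)
    qed
  qed
  also have "\<dots> = ennreal (2 / (b * \<tau> + 1)) * (\<integral>\<^sup>+ x. ennreal (\<bar>x\<bar> powr (a * \<tau>) * indicator I x) \<partial>lborel)"
    by (rule nn_integral_cmult) measurable
  also have "\<dots> < \<infinity>"
    unfolding nn_integral_abs_powr[OF a\<tau>] by (simp add: ennreal_mult_less_top)
  finally show ?thesis .
qed

text \<open>The function \<open>\<epsilon> * fibre_integral (-1/b + \<epsilon>) x\<close> is dominated by \<open>(2/b) \<bar>x\<bar>^(-a/b)\<close> through the
  monomial bound, and for fixed \<open>x \<noteq> 0\<close> it tends to \<open>0\<close> because the flat bound keeps the fibre
  integral bounded.\<close>

lemma residue_vanishes:
  assumes \<epsilon>: "\<And>n. 0 < \<epsilon> n" "\<And>n. \<epsilon> n \<le> 1/b" and lim: "\<epsilon> \<longlonglongrightarrow> 0"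
  shows "(\<lambda>n. \<integral>\<^sup>+ z. \<epsilon> n * local_power (- (1/b) + \<epsilon> n) z \<partial>lborel) \<longlonglongrightarrow> 0"
proof -
  have b: "real b > 0" using ab by simp
  define \<sigma> where "\<sigma> n = - (1/b) + \<epsilon> n" for n
  have \<sigma>: "- (1/b) < \<sigma> n" "\<sigma> n \<le> 0" for n using \<epsilon>[of n] by (auto simp: \<sigma>_def)
  have b\<sigma>: "b * \<sigma> n + 1 = b * \<epsilon> n" for n using b by (simp add: \<sigma>_def field_simps)
  define \<alpha> where "\<alpha> = - (real a / b)"
  have \<alpha>: "\<alpha> > -1" using ab by (simp add: \<alpha>_def)
  define u where "u n x = ennreal (\<epsilon> n) * (indicator I x * fibre_integral (\<sigma> n) x)" for n x
  define g where "g x = ennreal (2/b) * ennreal (\<bar>x\<bar> powr \<alpha> * indicator I x)" for x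
  have [measurable]: "g \<in> borel_measurable borel" unfolding g_def[abs_def] by measurable
  have "(\<lambda>n. \<integral>\<^sup>+ x. u n x \<partial>lborel) \<longlonglongrightarrow> integral\<^sup>N lborel (\<lambda>x::real. 0)"
  proof (rule nn_integral_dominated_convergence[where w = g])
    fix n
    show "AE x in lborel. u n x \<le> g x"
      using AE_lborel_singleton[of 0]
    proof eventually_elim
      case (elim x)
      show ?case
      proof (cases "x \<in> I")
        case True
        have "u n x \<le> ennreal (\<epsilon> n) * ennreal (\<bar>x\<bar> powr (a * \<sigma> n) * (2 / (b * \<sigma> n + 1)))"
          using fibre_integral_le_monomial[OF elim \<sigma>] True by (simp add: u_def mult_left_mono)
        also have "\<dots> = ennreal (\<bar>x\<bar> powr (a * \<sigma> n) * (2 / b))"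
          unfolding b\<sigma> using b \<epsilon>(1)[of n] by (simp add: ennreal_mult[symmetric])
        also have "\<dots> \<le> ennreal (\<bar>x\<bar> powr \<alpha> * (2 / b))"
        proof (intro ennreal_leI mult_right_mono powr_mono')
          have "a * (- (1/b)) \<le> a * \<sigma> n" using \<sigma>(1)[of n] by (intro mult_left_mono) auto
          thus "\<alpha> \<le> a * \<sigma> n" by (simp add: \<alpha>_def)
        qed (use True b in auto)
        also have "\<dots> = g x" using True b by (simp add: g_def ennreal_mult[symmetric] mult.commute)
        finally show ?thesis .
      qed (simp add: u_def)
    qed
  next
    show "(\<integral>\<^sup>+ x. g x \<partial>lborel) < \<infinity>"
      unfolding g_def using nn_integral_abs_powr[OF \<alpha>]
      by (subst nn_integral_cmult) (auto simp: ennreal_mult_less_top)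
  next
    show "AE x in lborel. (\<lambda>n. u n x) \<longlonglongrightarrow> 0"
      using AE_lborel_singleton[of 0]
    proof eventually_elim
      case (elim x)
      show ?case
      proof (cases "x \<in> I")
        case True
        obtain K where K: "fibre_integral (\<sigma> n) x \<le> ennreal K" for n
          using fibre_integral_le_flat[OF elim True] \<sigma> less_imp_le by blast
        have "(\<lambda>n. ennreal (\<epsilon> n * max K 0)) \<longlonglongrightarrow> ennreal (0 * max K 0)"
          by (intro tendsto_ennrealI tendsto_mult lim tendsto_const)
        hence z: "(\<lambda>n. ennreal (\<epsilon> n * max K 0)) \<longlonglongrightarrow> 0" by simp
        show ?thesis
        proof (rule tendsto_sandwich[OF _ _ tendsto_const z])
          show "\<forall>\<^sub>F n in sequentially. u n x \<le> ennreal (\<epsilon> n * max K 0)"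
          proof (intro always_eventually allI)
            fix n
            have "fibre_integral (\<sigma> n) x \<le> ennreal (max K 0)"
              using K[of n] by (rule order_trans) (intro ennreal_leI, simp)
            thus "u n x \<le> ennreal (\<epsilon> n * max K 0)"
              using True \<epsilon>(1)[of n] by (simp add: u_def ennreal_mult less_imp_le mult_left_mono)
          qed
        qed auto
      qed (simp add: u_def)
    qed
  qed (auto simp: u_def g_def)
  moreover have "(\<integral>\<^sup>+ z. \<epsilon> n * local_power (- (1/b) + \<epsilon> n) z \<partial>lborel) = (\<integral>\<^sup>+ x. u n x \<partial>lborel)" for n
  proof -
    have "(\<integral>\<^sup>+ z. \<epsilon> n * local_power (\<sigma> n) z \<partial>lborel)
        = (\<integral>\<^sup>+ z. ennreal (\<epsilon> n) * ennreal (local_power (\<sigma> n) z) \<partial>lborel)"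
      using \<epsilon>(1)[of n] by (intro nn_integral_cong ennreal_mult) (auto simp: local_power_def)
    also have "\<dots> = ennreal (\<epsilon> n) * (\<integral>\<^sup>+ z. local_power (\<sigma> n) z \<partial>lborel)"
      by (rule nn_integral_cmult) measurable
    also have "\<dots> = (\<integral>\<^sup>+ x. u n x \<partial>lborel)"
      unfolding nn_integral_local_power u_def by (rule nn_integral_cmult[symmetric]) measurable
    finally show ?thesis by (simp add: \<sigma>_def)
  qed
  ultimately show ?thesis by simp
qed

section \<open>Divergence to the left of \<open>-1/b\<close>\<close>

text \<open>The hypotheses keep the point so far from the axes that each flat term is at most the monomial.\<close>

lemma abs_f_le_monomial:
  assumes "x > 0" "y > 0" and E: "flat_exp p x \<le> y ^ q" and E': "flat_exp p' y \<le> x ^ q'"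
  shows "\<bar>f (x, y)\<bar> \<le> 3 * (x ^ a * y ^ b)"
proof -
  have "x ^ a * y ^ (b - q) * flat_exp p x \<le> x ^ a * y ^ (b - q) * y ^ q"
    using assms by (intro mult_left_mono E) auto
  also have "\<dots> = x ^ a * y ^ b" using q by (simp add: mult.assoc flip: power_add)
  finally have 1: "x ^ a * y ^ (b - q) * flat_exp p x \<le> x ^ a * y ^ b" .
  have "x ^ (a - q') * y ^ b * flat_exp p' y \<le> x ^ (a - q') * y ^ b * x ^ q'"
    using assms by (intro mult_left_mono E') auto
  also have "\<dots> = x ^ (a - q') * x ^ q' * y ^ b" by simp
  also have "\<dots> = x ^ a * y ^ b" using q' by (simp flip: power_add)
  finally have 2: "x ^ (a - q') * y ^ b * flat_exp p' y \<le> x ^ a * y ^ b" .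
  have "\<bar>f (x, y)\<bar> = x ^ a * y ^ b + x ^ a * y ^ (b - q) * flat_exp p x + x ^ (a - q') * y ^ b * flat_exp p' y"
    unfolding abs_f using assms by simp
  thus ?thesis using 1 2 by linarith
qed

lemma emeasure_lborel_rectangle:
  fixes s t u v :: real
  assumes "s \<le> t" "u \<le> v"
  shows "emeasure lborel ({s..t} \<times> {u..v}) = ennreal ((t - s) * (v - u))"
  using assms lborel.emeasure_pair_measure_Times[of "{s..t}" lborel "{u..v}"]
  by (simp add: lborel_prod ennreal_mult)

text \<open>It is enough to look at the boxes \<open>A = [t,2t] \<times> [d,2d]\<close> with \<open>d ^ q = flat_exp p (2 * t)\<close>, which is the
  smallest height at which the first flat term is still controlled. The second flat term is then doubly
  exponentially small in \<open>1/t\<close>. As \<open>t \<rightarrow> 0\<close> the integral over a single box already tends to infinity.\<close>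

lemma integral_diverges:
  fixes \<phi> :: "real \<times> real \<Rightarrow> real"
  assumes \<sigma>: "\<sigma> < - (1/b)" and "\<kappa> > 0" "\<eta> > 0"
    and nn: "\<And>z. \<phi> z \<ge> 0"
    and box: "\<And>x y. 0 < x \<Longrightarrow> x < \<eta> \<Longrightarrow> 0 < y \<Longrightarrow> y < \<eta> \<Longrightarrow> \<phi> (x, y) \<ge> \<kappa>"
  shows "(\<integral>\<^sup>+ z. \<bar>f z\<bar> powr \<sigma> * \<phi> z \<partial>lborel) = \<infinity>"
proof (rule ccontr)
  assume "\<not> ?thesis"
  then obtain S where S: "(\<integral>\<^sup>+ z. \<bar>f z\<bar> powr \<sigma> * \<phi> z \<partial>lborel) = ennreal S" "S \<ge> 0"
    by (cases "\<integral>\<^sup>+ z. \<bar>f z\<bar> powr \<sigma> * \<phi> z \<partial>lborel") auto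
  have b: "real b > 0" using ab by simp
  have \<sigma>0: "\<sigma> < 0" using \<sigma> b by (smt (verit) zero_less_divide_1_iff)
  have b\<sigma>: "b * \<sigma> + 1 < 0" using \<sigma> b by (simp add: field_simps)
  \<comment> \<open>With this \<open>k\<close>, \<open>(exp (- k / t powr p)) ^ q = flat_exp p (2 * t)\<close>.\<close>
  define k where "k = 1 / (q * 2 powr p)"
  have k: "k > 0" using q by (simp add: k_def)
  define d where "d t = exp (- k / t powr p)" for t :: real
  \<comment> \<open>\<open>C * t powr (a \<sigma> + 1) * exp (K / t powr p)\<close> is the lower bound for the integral over the box, and
    \<open>exp (- C' * exp (k' / t powr p)) = flat_exp p' (2 * d t)\<close>.\<close>
  define C where "C = \<kappa> * 3 powr \<sigma> * 2 powr (a * \<sigma>) * 2 powr (b * \<sigma>)"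
  define K where "K = - k * (b * \<sigma> + 1)"
  define C' where "C' = 2 powr (- p')"
  define k' where "k' = k * p'"
  have pos: "C > 0" "K > 0" "C' > 0" "k' > 0"
    using \<open>\<kappa> > 0\<close> k b\<sigma> p' by (auto simp: C_def K_def C'_def k'_def mult_neg_neg mult_less_0_iff)
  have "filterlim (\<lambda>t::real. C * t powr (a * \<sigma> + 1) * exp (K / t powr p)) at_top (at_right 0)"
    using pos p by real_asymp
  hence "\<forall>\<^sub>F t in at_right 0. S < C * t powr (a * \<sigma> + 1) * exp (K / t powr p)"
    by (simp add: filterlim_at_top_dense)
  moreover have "\<forall>\<^sub>F t in at_right 0. exp (- C' * exp (k' / t powr p)) \<le> t powr real q'"
    using pos p by real_asymp
  moreover have "((\<lambda>t. 2 * d t) \<longlongrightarrow> 0) (at_right 0)"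
    unfolding d_def using k p by real_asymp
  hence "\<forall>\<^sub>F t in at_right 0. 2 * d t < \<eta>"
    using \<open>\<eta> > 0\<close> by (rule order_tendstoD)
  moreover have "\<forall>\<^sub>F t in at_right 0. t \<in> {0<..<\<eta>/2}"
    using \<open>\<eta> > 0\<close> by (intro eventually_at_right_real) simp
  ultimately have "\<forall>\<^sub>F t in at_right (0::real). False"
  proof eventually_elim
    case (elim t)
    have t: "t > 0" "2 * t < \<eta>" using elim by auto
    have d: "d t > 0" by (simp add: d_def)
    define m where "m = 3 * ((2 * t) ^ a * (2 * d t) ^ b)"
    have m: "m > 0" using t d by (simp add: m_def)
    define A where "A = {t..2 * t} \<times> {d t..2 * d t}"
    have lower: "\<kappa> * m powr \<sigma> \<le> \<bar>f z\<bar> powr \<sigma> * \<phi> z" if "z \<in> A" for z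
    proof -
      obtain x y where z: "z = (x, y)" by (cases z)
      have x: "t \<le> x" "x \<le> 2 * t" and y: "d t \<le> y" "y \<le> 2 * d t" using that by (auto simp: A_def z)
      have xy: "x > 0" "y > 0" using x y t d by linarith+
      have "flat_exp p x \<le> flat_exp p (2 * t)" using p xy x by (intro flat_exp_mono) auto
      also have "\<dots> = d t ^ q"
        using t q p by (simp add: flat_exp_def d_def k_def powr_mult field_simps flip: exp_of_nat_mult)
      also have "\<dots> \<le> y ^ q" using d y by (intro power_mono) auto
      finally have E: "flat_exp p x \<le> y ^ q" .
      have "flat_exp p' y \<le> flat_exp p' (2 * d t)" using p' xy y by (intro flat_exp_mono) auto
      also have "\<dots> = exp (- C' * exp (k' / t powr p))"
      proof -
        have "\<bar>2 * d t\<bar> powr p' = 2 powr p' * exp (- (k' / t powr p))"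
          by (simp add: d_def powr_mult exp_powr_real k'_def)
        thus ?thesis using d by (simp add: flat_exp_def C'_def powr_minus exp_minus field_simps)
      qed
      also have "\<dots> \<le> t powr q'" using elim by simp
      also have "\<dots> = t ^ q'" using t by (simp add: powr_realpow)
      also have "\<dots> \<le> x ^ q'" using x t by (intro power_mono) auto
      finally have E': "flat_exp p' y \<le> x ^ q'" .
      have "\<bar>f (x, y)\<bar> \<le> 3 * (x ^ a * y ^ b)" by (rule abs_f_le_monomial[OF xy E E'])
      also have "\<dots> \<le> m" unfolding m_def
        using x y xy by (intro mult_left_mono mult_mono power_mono) auto
      finally have "m powr \<sigma> \<le> \<bar>f z\<bar> powr \<sigma>"
        using f_nonzero[of x y] xy \<sigma>0 unfolding z by (intro powr_mono2') auto
      moreover have "\<kappa> \<le> \<phi> z" unfolding z using x y xy t elim by (intro box) auto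
      ultimately have "m powr \<sigma> * \<kappa> \<le> \<bar>f z\<bar> powr \<sigma> * \<phi> z"
        using \<open>\<kappa> > 0\<close> by (intro mult_mono) auto
      thus ?thesis by (simp add: mult.commute)
    qed
    have A: "A \<in> sets borel" unfolding A_def by (intro borel_closed closed_Times closed_atLeastAtMost)
    have "ennreal (\<kappa> * m powr \<sigma> * (t * d t)) = ennreal (\<kappa> * m powr \<sigma>) * emeasure lborel A"
      using t d \<open>\<kappa> > 0\<close> unfolding A_def
      by (subst emeasure_lborel_rectangle) (auto simp: ennreal_mult)
    also have "\<dots> = (\<integral>\<^sup>+ z. ennreal (\<kappa> * m powr \<sigma>) * indicator A z \<partial>lborel)"
      using A by (simp add: nn_integral_cmult_indicator)
    also have "\<dots> \<le> (\<integral>\<^sup>+ z. \<bar>f z\<bar> powr \<sigma> * \<phi> z \<partial>lborel)"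
      using lower by (intro nn_integral_mono) (auto simp: indicator_def intro: ennreal_leI)
    also have "\<dots> = ennreal S" by (rule S)
    finally have "\<kappa> * m powr \<sigma> * (t * d t) \<le> S" using S(2) by simp
    moreover have "\<kappa> * m powr \<sigma> * (t * d t) = C * t powr (a * \<sigma> + 1) * exp (K / t powr p)"
    proof -
      have e1: "m powr \<sigma> = 3 powr \<sigma> * (2 powr (a * \<sigma>) * t powr (a * \<sigma>)) * (2 powr (b * \<sigma>) * d t powr (b * \<sigma>))"
        unfolding m_def using t d by (simp add: powr_mult powr_powr flip: powr_realpow)
      have e2: "t powr (a * \<sigma>) * t = t powr (a * \<sigma> + 1)" using t by (simp add: powr_add)
      have e3: "d t powr (b * \<sigma>) * d t = exp (K / t powr p)"
        by (simp add: d_def exp_powr_real K_def mult_exp_exp) (simp add: algebra_simps add_divide_distrib diff_divide_distrib)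
      show ?thesis unfolding C_def e1 e2[symmetric] e3[symmetric] by (simp add: mult_ac)
    qed
    ultimately show False using elim by simp
  qed
  thus False by simp
qed

end

section \<open>Smooth bump functions\<close>

text \<open>This reduces smoothness to first derivatives: it suffices to find a class that contains the function
  and the directional derivatives of its members.\<close>

lemma k_times_cont_differentiable_closed_class:
  assumes cls: "\<And>g. g \<in> S \<Longrightarrow> \<exists>D. (\<forall>x. (g has_derivative D x) (at x)) \<and> (\<forall>v. (\<lambda>x. D x v) \<in> S)"
  shows "g \<in> S \<Longrightarrow> k_times_cont_differentiable k g"
proof (induction k arbitrary: g)
  case 0
  then obtain D where "\<And>x. (g has_derivative D x) (at x)" using cls by blast
  thus ?case by (auto intro!: continuous_at_imp_continuous_on intro: has_derivative_continuous)
next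
  case (Suc k)
  then obtain D where D: "\<And>x. (g has_derivative D x) (at x)" "\<And>v. (\<lambda>x. D x v) \<in> S"
    using cls by blast
  have "frechet_derivative g (at x) = D x" for x
    using frechet_derivative_at[OF D(1)] by simp
  thus ?case using D Suc.IH by (auto simp: differentiable_def)
qed

text \<open>The derivatives of \<open>exp(-1/t)\<close> are combinations of these functions.\<close>

definition flat_quotient :: "nat \<Rightarrow> real \<Rightarrow> real" where
  "flat_quotient n t = (if t > 0 then exp (- (1 / t)) / t ^ n else 0)"

lemma flat_quotient_tendsto_0: "(flat_quotient n \<longlongrightarrow> 0) (at 0)"
proof -
  have "((\<lambda>t::real. exp (- (1 / t)) / t ^ n) \<longlongrightarrow> 0) (at_right 0)" by real_asymp
  moreover have "\<forall>\<^sub>F t in at_right 0. exp (- (1 / t)) / t ^ n = flat_quotient n t"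
    using eventually_at_right_less by eventually_elim (simp add: flat_quotient_def)
  ultimately have "(flat_quotient n \<longlongrightarrow> 0) (at_right 0)" by (rule Lim_transform_eventually)
  moreover have "\<forall>\<^sub>F t in at_left 0. 0 = flat_quotient n t"
    using eventually_at_left_real[of "-1" 0] by (auto elim!: eventually_mono simp: flat_quotient_def)
  hence "(flat_quotient n \<longlongrightarrow> 0) (at_left 0)"
    by (rule Lim_transform_eventually[OF tendsto_const])
  ultimately show ?thesis by (simp add: filterlim_at_split)
qed

lemma flat_quotient_deriv:
  "(flat_quotient n has_real_derivative flat_quotient (n + 2) t - real n * flat_quotient (n + 1) t) (at t)"
proof -
  consider "t > 0" | "t < 0" | "t = 0" by linarith
  thus ?thesis
  proof cases
    case 1
    have "((\<lambda>t. exp (- (1 / t)) / t ^ n) has_real_derivative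
        flat_quotient (n + 2) t - real n * flat_quotient (n + 1) t) (at t)"
      using 1 by (auto intro!: derivative_eq_intros simp: flat_quotient_def)
        (cases n; simp add: field_simps power2_eq_square)
    thus ?thesis
      by (rule has_field_derivative_transform_within_open[where S = "{0<..}"])
         (use 1 in \<open>auto simp: flat_quotient_def\<close>)
  next
    case 2
    have "((\<lambda>t. 0) has_real_derivative flat_quotient (n + 2) t - real n * flat_quotient (n + 1) t) (at t)"
      using 2 by (simp add: flat_quotient_def)
    thus ?thesis
      by (rule has_field_derivative_transform_within_open[where S = "{..<0}"])
         (use 2 in \<open>auto simp: flat_quotient_def\<close>)
  next
    case 3
    have "((\<lambda>h. (flat_quotient n (0 + h) - flat_quotient n 0) / h) \<longlongrightarrow> 0) (at 0)"
    proof (rule Lim_transform_eventually[OF flat_quotient_tendsto_0[of "Suc n"]])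
      show "\<forall>\<^sub>F h in at 0. flat_quotient (Suc n) h = (flat_quotient n (0 + h) - flat_quotient n 0) / h"
        by (auto simp: flat_quotient_def field_simps)
    qed
    thus ?thesis using 3 by (simp add: DERIV_def flat_quotient_def)
  qed
qed

text \<open>The algebra generated by the coordinates and the functions
  \<open>flat_quotient n (\<rho>\<^sup>2 - x\<^sup>2 - y\<^sup>2)\<close>. Higher derivatives of the bump function need not be computed, since the
  algebra is closed under directional derivatives.\<close>

inductive_set bump_class :: "real \<Rightarrow> (real \<times> real \<Rightarrow> real) set" for \<rho> where
  const: "(\<lambda>z. c) \<in> bump_class \<rho>"
| fst: "fst \<in> bump_class \<rho>"
| snd: "snd \<in> bump_class \<rho>"
| bump: "(\<lambda>z. flat_quotient n (\<rho>\<^sup>2 - (fst z)\<^sup>2 - (snd z)\<^sup>2)) \<in> bump_class \<rho>"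
| add: "g \<in> bump_class \<rho> \<Longrightarrow> h \<in> bump_class \<rho> \<Longrightarrow> (\<lambda>z. g z + h z) \<in> bump_class \<rho>"
| mult: "g \<in> bump_class \<rho> \<Longrightarrow> h \<in> bump_class \<rho> \<Longrightarrow> (\<lambda>z. g z * h z) \<in> bump_class \<rho>"

lemma bump_class_derivative:
  assumes "g \<in> bump_class \<rho>"
  shows "\<exists>D. (\<forall>x. (g has_derivative D x) (at x)) \<and> (\<forall>v. (\<lambda>x. D x v) \<in> bump_class \<rho>)"
  using assms
proof induction
  case (const c)
  show ?case by (rule exI[of _ "\<lambda>x v. 0"]) (auto intro: bump_class.const)
next
  case fst
  show ?case by (rule exI[of _ "\<lambda>x v. fst v"]) (auto intro: bump_class.const derivative_eq_intros)
next
  case snd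
  show ?case by (rule exI[of _ "\<lambda>x v. snd v"]) (auto intro: bump_class.const derivative_eq_intros)
next
  case (bump n)
  let ?u = "\<lambda>z::real \<times> real. \<rho>\<^sup>2 - (fst z)\<^sup>2 - (snd z)\<^sup>2"
  let ?G = "\<lambda>m z. flat_quotient m (?u z)"
  let ?D = "\<lambda>z v. (?G (n + 2) z + (- real n) * ?G (n + 1) z) * ((- 2 * fst v) * fst z + (- 2 * snd v) * snd z)"
  have "((\<lambda>z. ?G n z) has_derivative ?D x) (at x)" for x
  proof -
    have "(?u has_derivative (\<lambda>v. (- 2 * fst v) * fst x + (- 2 * snd v) * snd x)) (at x)"
      by (auto intro!: derivative_eq_intros)
    from has_derivative_compose[OF this flat_quotient_deriv[unfolded has_field_derivative_def]]
    show ?thesis by simp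
  qed
  moreover have "(\<lambda>z. ?D z v) \<in> bump_class \<rho>" for v
    by (intro bump_class.intros)
  ultimately show ?case by (intro exI[of _ ?D]) auto
next
  case (add g h)
  then obtain Dg Dh where "\<And>x. (g has_derivative Dg x) (at x)" "\<And>v. (\<lambda>x. Dg x v) \<in> bump_class \<rho>"
    "\<And>x. (h has_derivative Dh x) (at x)" "\<And>v. (\<lambda>x. Dh x v) \<in> bump_class \<rho>" by blast
  thus ?case
    by (intro exI[of _ "\<lambda>x v. Dg x v + Dh x v"]) (auto intro!: bump_class.add has_derivative_add)
next
  case (mult g h)
  then obtain Dg Dh where "\<And>x. (g has_derivative Dg x) (at x)" "\<And>v. (\<lambda>x. Dg x v) \<in> bump_class \<rho>"
    "\<And>x. (h has_derivative Dh x) (at x)" "\<And>v. (\<lambda>x. Dh x v) \<in> bump_class \<rho>" by blast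
  with mult.hyps show ?case
    by (intro exI[of _ "\<lambda>x v. g x * Dh x v + Dg x v * h x"])
       (auto intro!: bump_class.add bump_class.mult has_derivative_mult)
qed

lemma smooth_of_real_bump_class:
  assumes "g \<in> bump_class \<rho>"
  shows "smooth (\<lambda>z. complex_of_real (g z))"
  unfolding smooth_def
proof
  fix k
  show "k_times_cont_differentiable k (\<lambda>z. complex_of_real (g z))"
  proof (rule k_times_cont_differentiable_closed_class[where S = "(\<lambda>g z. complex_of_real (g z)) ` bump_class \<rho>"])
    fix G assume "G \<in> (\<lambda>g z. complex_of_real (g z)) ` bump_class \<rho>"
    then obtain g where g: "G = (\<lambda>z. complex_of_real (g z))" "g \<in> bump_class \<rho>" by blast
    obtain D where D: "\<And>x. (g has_derivative D x) (at x)" "\<And>v. (\<lambda>x. D x v) \<in> bump_class \<rho>"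
      using bump_class_derivative[OF g(2)] by blast
    show "\<exists>D. (\<forall>x. (G has_derivative D x) (at x)) \<and> (\<forall>v. (\<lambda>x. D x v) \<in> (\<lambda>g z. complex_of_real (g z)) ` bump_class \<rho>)"
      using D unfolding g(1)
      by (intro exI[of _ "\<lambda>x v. complex_of_real (D x v)"]) (auto intro!: has_derivative_of_real)
  qed (use assms in blast)
qed

lemma ex_bump_function:
  fixes U :: "(real \<times> real) set"
  assumes "open U" "(0, 0) \<in> U"
  obtains \<phi> :: "real \<times> real \<Rightarrow> real" where "(\<lambda>z. complex_of_real (\<phi> z)) \<in> test_functions U"
    "\<phi> (0, 0) > 0" "\<And>z. \<phi> z \<ge> 0"
proof -
  obtain \<rho> where \<rho>: "\<rho> > 0" "cball (0, 0) \<rho> \<subseteq> U"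
    using assms open_contains_cball by blast
  define \<phi> where "\<phi> z = flat_quotient 0 (\<rho>\<^sup>2 - (fst z)\<^sup>2 - (snd z)\<^sup>2)" for z :: "real \<times> real"
  have "{z. complex_of_real (\<phi> z) \<noteq> 0} \<subseteq> cball (0, 0) \<rho>"
  proof clarify
    fix x y assume "complex_of_real (\<phi> (x, y)) \<noteq> 0"
    hence "x\<^sup>2 + y\<^sup>2 < \<rho>\<^sup>2" by (auto simp: \<phi>_def flat_quotient_def split: if_splits)
    hence "sqrt (x\<^sup>2 + y\<^sup>2) < \<rho>" using \<rho> by (intro real_less_lsqrt) auto
    thus "(x, y) \<in> cball (0, 0) \<rho>" by (simp add: dist_norm norm_Pair)
  qed
  hence sub: "closure {z. complex_of_real (\<phi> z) \<noteq> 0} \<subseteq> cball (0, 0) \<rho>"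
    by (rule closure_minimal) simp
  have "compact (closure {z. complex_of_real (\<phi> z) \<noteq> 0})"
    using compact_Int_closed[OF compact_cball closed_closure] sub by (metis inf.absorb_iff2)
  moreover have "smooth (\<lambda>z. complex_of_real (\<phi> z))"
    unfolding \<phi>_def by (rule smooth_of_real_bump_class[OF bump_class.bump])
  ultimately show ?thesis
    using \<rho> sub by (intro that[of \<phi>]) (auto simp: test_functions_def \<phi>_def flat_quotient_def)
qed

section \<open>The local zeta function\<close>

context flat_perturbation begin

text \<open>The truncation at \<open>0\<close> makes the weight nonnegative everywhere, also far from the origin, where \<open>\<bar>f\<bar>\<close> may
  exceed \<open>1\<close> but the test functions vanish.\<close>

definition weight :: "real \<times> real \<Rightarrow> real" where
  "weight z = max 0 (- ln \<bar>f z\<bar>)"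

text \<open>Since \<open>ln 0 = 0\<close>, the weight of a zero of \<open>f\<close> is \<open>0\<close> and its exponential is \<open>1\<close>, whereas
  \<open>0 powr s = 0\<close>. Deleting the zeros of \<open>f\<close> from the test function makes the zeta integrand equal to the
  Laplace integrand at every point.\<close>

definition cut :: "(real \<times> real \<Rightarrow> 'a::zero) \<Rightarrow> real \<times> real \<Rightarrow> 'a" where
  "cut \<phi> z = (if f z = 0 then 0 else \<phi> z)"

lemma exp_weight:
  assumes "z \<in> I \<times> I" "f z \<noteq> 0"
  shows "exp (- \<sigma> * weight z) = \<bar>f z\<bar> powr \<sigma>"
    and "exp (- s * of_real (weight z)) = complex_of_real \<bar>f z\<bar> powr s"
proof -
  obtain x y where z: "z = (x, y)" by (cases z)
  have "\<bar>f z\<bar> < 1" unfolding z by (rule abs_f_less_1) (use assms in \<open>auto simp: z abs_le_iff\<close>)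
  hence w: "weight z = - ln \<bar>f z\<bar>" using assms(2) by (simp add: weight_def)
  show "exp (- \<sigma> * weight z) = \<bar>f z\<bar> powr \<sigma>" using assms(2) by (simp add: w powr_def)
  show "exp (- s * of_real (weight z)) = complex_of_real \<bar>f z\<bar> powr s"
    using assms(2) by (simp add: w powr_def Ln_of_real)
qed

lemma test_function_facts:
  fixes \<phi> :: "real \<times> real \<Rightarrow> complex"
  assumes "\<phi> \<in> test_functions U" "U \<subseteq> ball (0, 0) (1/2)"
  shows "continuous_on UNIV \<phi>"
    and "\<phi> z \<noteq> 0 \<Longrightarrow> z \<in> U \<and> z \<in> I \<times> I"
    and "\<exists>C\<ge>0. \<forall>z. cmod (\<phi> z) \<le> C"
proof -
  have "k_times_cont_differentiable 0 \<phi>" using assms by (auto simp: test_functions_def smooth_def)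
  thus c: "continuous_on UNIV \<phi>" by simp
  show "z \<in> U \<and> z \<in> I \<times> I" if "\<phi> z \<noteq> 0" for z
  proof -
    have "z \<in> U" using that assms(1) closure_subset by (fastforce simp: test_functions_def)
    moreover obtain x y where z: "z = (x, y)" by (cases z)
    ultimately have "(x, y) \<in> ball (0, 0) (1/2)" using assms(2) by blast
    hence "norm (x, y) < 1/2" by (simp add: dist_norm norm_Pair)
    hence "\<bar>x\<bar> < 1/2" "\<bar>y\<bar> < 1/2"
      using norm_fst_le[of x y] norm_snd_le[of y x] by auto
    thus ?thesis using \<open>z \<in> U\<close> by (auto simp: z)
  qed
  let ?K = "closure {z. \<phi> z \<noteq> 0}"
  have "compact (\<phi> ` ?K)"
    using assms(1) c by (intro compact_continuous_image) (auto simp: test_functions_def intro: continuous_on_subset)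
  hence "bounded (\<phi> ` ?K)" by (rule compact_imp_bounded)
  then obtain C where C: "\<And>z. z \<in> ?K \<Longrightarrow> cmod (\<phi> z) \<le> C"
    unfolding bounded_iff by blast
  have "cmod (\<phi> z) \<le> max C 0" for z
  proof (cases "\<phi> z = 0")
    case False
    hence "z \<in> ?K" using closure_subset[of "{z. \<phi> z \<noteq> 0}"] by blast
    hence "cmod (\<phi> z) \<le> C" by (rule C)
    thus ?thesis by linarith
  qed simp
  thus "\<exists>C\<ge>0. \<forall>z. cmod (\<phi> z) \<le> C" by (intro exI[of _ "max C 0"]) auto
qed

lemma zeta_integrand_eq:
  assumes "{z. \<phi> z \<noteq> 0} \<subseteq> I \<times> I"
  shows "zeta_integrand f \<phi> s = (\<lambda>z. exp (- s * of_real (weight z)) * cut \<phi> z)"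
proof
  fix z
  show "zeta_integrand f \<phi> s z = exp (- s * of_real (weight z)) * cut \<phi> z"
    using exp_weight(2)[of z s] assms
    by (cases "\<phi> z = 0") (auto simp: zeta_integrand_def cut_def)
qed

lemma local_zeta_eq_laplace:
  assumes "{z. \<phi> z \<noteq> 0} \<subseteq> I \<times> I"
  shows "local_zeta f \<phi> = laplace lborel weight (cut \<phi>)"
  unfolding local_zeta_def[abs_def] laplace_def[abs_def] zeta_integrand_eq[OF assms] ..

lemma norm_laplace_integrand_le:
  assumes "{z. \<phi> z \<noteq> 0} \<subseteq> I \<times> I" "\<And>z. cmod (\<phi> z) \<le> C"
  shows "exp (- \<sigma> * weight z) * cmod (cut \<phi> z) \<le> C * local_power \<sigma> z"
proof (cases "cut \<phi> z = 0")
  case True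
  have "C \<ge> 0" using assms(2)[of z] norm_ge_zero order_trans by blast
  thus ?thesis using True by (simp add: local_power_def)
next
  case False
  hence "f z \<noteq> 0" "\<phi> z \<noteq> 0" by (auto simp: cut_def split: if_splits)
  thus ?thesis using exp_weight(1)[of z \<sigma>] assms(1) assms(2)[of z] subsetD[OF assms(1), of z]
    by (simp add: cut_def local_power_def mult.commute mult_left_mono)
qed

lemma laplace_convergent_cut:
  assumes \<phi>: "\<phi> \<in> test_functions U" "U \<subseteq> ball (0, 0) (1/2)"
  shows "laplace_convergent lborel weight (cut \<phi>) (- (1/b))"
proof
  show w: "weight \<in> borel_measurable lborel"
    unfolding weight_def[abs_def] by measurable
  have [measurable]: "\<phi> \<in> borel_measurable borel"
    using test_function_facts(1)[OF \<phi>] by (rule borel_measurable_continuous_onI)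
  show c: "cut \<phi> \<in> borel_measurable lborel"
    unfolding cut_def[abs_def] by measurable
  show "0 \<le> weight z" for z by (simp add: weight_def)
  fix \<sigma> :: real assume \<sigma>: "- (1/b) < \<sigma>"
  obtain C where C: "C \<ge> 0" "\<And>z. cmod (\<phi> z) \<le> C" using test_function_facts(3)[OF \<phi>] by blast
  have supp: "{z. \<phi> z \<noteq> 0} \<subseteq> I \<times> I" using test_function_facts(2)[OF \<phi>] by blast
  have lp: "integrable lborel (\<lambda>z. C * local_power \<sigma> z)"
  proof (intro integrable_mult_right integrableI_nonneg)
    show "(\<integral>\<^sup>+ z. local_power \<sigma> z \<partial>lborel) < \<infinity>" by (rule local_power_integral_finite[OF \<sigma>])
    show "local_power \<sigma> \<in> borel_measurable lborel" by measurable
    show "AE z in lborel. 0 \<le> local_power \<sigma> z" by (simp add: local_power_def)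
  qed
  show "integrable lborel (\<lambda>z. exp (- \<sigma> * weight z) * cmod (cut \<phi> z))"
  proof (rule Bochner_Integration.integrable_bound[OF lp])
    show "AE z in lborel. norm (exp (- \<sigma> * weight z) * cmod (cut \<phi> z)) \<le> norm (C * local_power \<sigma> z)"
    proof (rule AE_I2)
      fix z
      have "norm (exp (- \<sigma> * weight z) * cmod (cut \<phi> z)) = exp (- \<sigma> * weight z) * cmod (cut \<phi> z)" by simp
      also have "\<dots> \<le> C * local_power \<sigma> z" by (rule norm_laplace_integrand_le[OF supp C(2)])
      also have "\<dots> \<le> norm (C * local_power \<sigma> z)" by simp
      finally show "norm (exp (- \<sigma> * weight z) * cmod (cut \<phi> z)) \<le> norm (C * local_power \<sigma> z)" .
    qed
  qed (use w c in measurable)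
qed

lemma zeta_on_half_plane:
  assumes \<phi>: "\<phi> \<in> test_functions U" "U \<subseteq> ball (0, 0) (1/2)"
  shows "s \<in> right_half_plane (- (1/b)) \<Longrightarrow> integrable lborel (zeta_integrand f \<phi> s)"
    and "local_zeta f \<phi> holomorphic_on right_half_plane (- (1/b))"
proof -
  interpret laplace_convergent lborel weight "cut \<phi>" "- (1/b)" by (rule laplace_convergent_cut[OF \<phi>])
  have supp: "{z. \<phi> z \<noteq> 0} \<subseteq> I \<times> I" using test_function_facts(2)[OF \<phi>] by blast
  show "integrable lborel (zeta_integrand f \<phi> s)" if "s \<in> right_half_plane (- (1/b))"
    unfolding zeta_integrand_eq[OF supp]
    by (rule integrable_laplace) (use that in \<open>simp add: right_half_plane_def\<close>)
  show "local_zeta f \<phi> holomorphic_on right_half_plane (- (1/b))"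
    unfolding local_zeta_eq_laplace[OF supp] by (rule holomorphic_laplace)
qed

lemma zeta_residue_vanishes:
  assumes \<phi>: "\<phi> \<in> test_functions U" "U \<subseteq> ball (0, 0) (1/2)"
    and \<epsilon>: "\<And>n. 0 < \<epsilon> n" "\<And>n. \<epsilon> n \<le> 1/b" "\<epsilon> \<longlonglongrightarrow> 0"
  shows "(\<lambda>n. of_real (\<epsilon> n) * local_zeta f \<phi> (of_real (- (1/b) + \<epsilon> n))) \<longlonglongrightarrow> 0"
proof -
  obtain C where C: "C \<ge> 0" "\<And>z. cmod (\<phi> z) \<le> C" using test_function_facts(3)[OF \<phi>] by blast
  have supp: "{z. \<phi> z \<noteq> 0} \<subseteq> I \<times> I" using test_function_facts(2)[OF \<phi>] by blast
  interpret laplace_convergent lborel weight "cut \<phi>" "- (1/b)" by (rule laplace_convergent_cut[OF \<phi>])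
  define J where "J n = (\<integral>\<^sup>+ z. \<epsilon> n * local_power (- (1/b) + \<epsilon> n) z \<partial>lborel)" for n
  have J: "J \<longlonglongrightarrow> 0" unfolding J_def by (rule residue_vanishes[OF \<epsilon>])
  have le: "ennreal (cmod (of_real (\<epsilon> n) * local_zeta f \<phi> (of_real (- (1/b) + \<epsilon> n)))) \<le> ennreal C * J n" for n
  proof -
    let ?\<sigma> = "- (1/b) + \<epsilon> n"
    let ?h = "\<lambda>z. of_real (\<epsilon> n) * (exp (- of_real ?\<sigma> * of_real (weight z)) * cut \<phi> z)"
    have "integrable lborel ?h"
      by (intro integrable_mult_right integrable_laplace) (use \<epsilon>(1)[of n] in simp)
    hence "ennreal (norm (integral\<^sup>L lborel ?h)) \<le> (\<integral>\<^sup>+ z. norm (?h z) \<partial>lborel)"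
      by (rule integral_norm_bound_ennreal)
    also have "\<dots> \<le> (\<integral>\<^sup>+ z. ennreal C * ennreal (\<epsilon> n * local_power ?\<sigma> z) \<partial>lborel)"
    proof (rule nn_integral_mono)
      fix z
      have "norm (?h z) = \<epsilon> n * (exp (- ?\<sigma> * weight z) * cmod (cut \<phi> z))"
        using \<epsilon>(1)[of n] by (simp add: norm_mult flip: of_real_mult of_real_minus exp_of_real)
      also have "\<dots> \<le> \<epsilon> n * (C * local_power ?\<sigma> z)"
        using \<epsilon>(1)[of n] by (intro mult_left_mono norm_laplace_integrand_le[OF supp C(2)]) auto
      also have "\<dots> = C * (\<epsilon> n * local_power ?\<sigma> z)" by simp
      finally have "ennreal (norm (?h z)) \<le> ennreal (C * (\<epsilon> n * local_power ?\<sigma> z))" by (rule ennreal_leI)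
      also have "\<dots> = ennreal C * ennreal (\<epsilon> n * local_power ?\<sigma> z)"
        using C(1) \<epsilon>(1)[of n] by (intro ennreal_mult) (auto simp: local_power_def)
      finally show "ennreal (norm (?h z)) \<le> ennreal C * ennreal (\<epsilon> n * local_power ?\<sigma> z)" .
    qed
    also have "\<dots> = ennreal C * J n"
      unfolding J_def by (rule nn_integral_cmult) measurable
    also have "integral\<^sup>L lborel ?h = of_real (\<epsilon> n) * local_zeta f \<phi> (of_real ?\<sigma>)"
      unfolding local_zeta_eq_laplace[OF supp] laplace_def by (rule integral_mult_right_zero)
    finally show ?thesis .
  qed
  have "(\<lambda>n. ennreal C * J n) \<longlonglongrightarrow> ennreal C * 0"
    using J by (intro tendsto_mult_ennreal tendsto_const) auto
  hence "(\<lambda>n. ennreal C * J n) \<longlonglongrightarrow> 0" by simp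
  from tendsto_sandwich[OF _ _ tendsto_const this]
  have "(\<lambda>n. ennreal (cmod (of_real (\<epsilon> n) * local_zeta f \<phi> (of_real (- (1/b) + \<epsilon> n))))) \<longlonglongrightarrow> ennreal 0"
    using le by simp
  thus ?thesis
    by (subst (asm) tendsto_ennreal_iff) (auto simp: tendsto_norm_zero_iff)
qed

section \<open>The singularity at \<open>-1/b\<close>\<close>

text \<open>A pole is excluded by letting \<open>s \<rightarrow> -1/b\<close> along the real axis, where \<open>(s + 1/b) g(s)\<close> tends to
  \<open>0\<close>, and a removable singularity by playing \<open>landau_convergence\<close> against \<open>integral_diverges\<close>.\<close>

lemma no_meromorphic_germ:
  fixes \<phi> :: "real \<times> real \<Rightarrow> real"
  assumes \<phi>: "(\<lambda>z. complex_of_real (\<phi> z)) \<in> test_functions U" "U \<subseteq> ball (0, 0) (1/2)"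
    and nn: "\<And>z. \<phi> z \<ge> 0" and pos: "\<phi> (0, 0) > 0"
    and g: "g meromorphic_on {of_real (- (1/b))}"
    and e: "e > 0" and eq: "\<And>s. s \<in> ball (of_real (- (1/b))) e \<Longrightarrow> - (1/b) < Re s \<Longrightarrow>
               g s = local_zeta f (\<lambda>z. of_real (\<phi> z)) s"
  shows False
proof -
  define \<sigma>\<^sub>0 where "\<sigma>\<^sub>0 = - (1 / real b)"
  define s\<^sub>0 where "s\<^sub>0 = complex_of_real \<sigma>\<^sub>0"
  have b: "real b > 0" using ab by simp
  have supp: "{z. complex_of_real (\<phi> z) \<noteq> 0} \<subseteq> I \<times> I"
    using test_function_facts(2)[OF \<phi>] by blast
  have "isolated_singularity_at g s\<^sub>0" and ness: "not_essential g s\<^sub>0"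
    using g by (auto simp: meromorphic_at_iff s\<^sub>0_def \<sigma>\<^sub>0_def)
  then obtain e' where e': "e' > 0" "g analytic_on ball s\<^sub>0 e' - {s\<^sub>0}"
    unfolding isolated_singularity_at_def by blast
  from ness consider (removable) c where "g \<midarrow>s\<^sub>0\<rightarrow> c" | (pole) "is_pole g s\<^sub>0"
    by (auto simp: not_essential_def)
  thus False
  proof cases
    case pole
    have "g holomorphic_on ball s\<^sub>0 e' - {s\<^sub>0}" using e'(2) by (rule analytic_imp_holomorphic)
    from zorder_exist_pole[OF this _ _ pole] e'(1) obtain r where r: "r > 0" "zorder g s\<^sub>0 < 0"
      "zor_poly g s\<^sub>0 s\<^sub>0 \<noteq> 0" "zor_poly g s\<^sub>0 holomorphic_on cball s\<^sub>0 r"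
      "\<And>s. s \<in> cball s\<^sub>0 r - {s\<^sub>0} \<Longrightarrow> g s = zor_poly g s\<^sub>0 s / (s - s\<^sub>0) ^ nat (- zorder g s\<^sub>0)"
      by auto
    define P where "P = zor_poly g s\<^sub>0"
    obtain m where m: "nat (- zorder g s\<^sub>0) = Suc m" using r(2) by (cases "nat (- zorder g s\<^sub>0)") auto
    have b1: "0 < 1 / real b" "1 / real b \<le> 1" using ab by auto
    define \<delta> where "\<delta> = min (min r (e/2)) (1 / real b)"
    have "\<delta> > 0" using r(1) e b1(1) by (simp only: \<delta>_def min_less_iff_conj) simp
    moreover have "\<delta> \<le> r" "\<delta> \<le> e/2" "\<delta> \<le> 1 / real b"
      unfolding \<delta>_def by (simp_all only: min_le_iff_disj order_refl simp_thms)
    ultimately have \<delta>: "\<delta> > 0" "\<delta> \<le> r" "\<delta> < e" "\<delta> \<le> 1" "\<delta> \<le> 1 / real b"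
      using b1 e by linarith+
    \<comment> \<open>With \<open>P\<close> the holomorphic numerator of \<open>g\<close> and \<open>Suc m\<close> the order of the pole,
      \<open>\<epsilon> \<bar>g(s\<^sub>0 + \<epsilon>)\<bar> = \<bar>P(s\<^sub>0 + \<epsilon>)\<bar> / \<epsilon>^m \<ge> \<bar>P(s\<^sub>0 + \<epsilon>)\<bar>\<close> for \<open>\<epsilon> \<le> 1\<close>, which forces \<open>P(s\<^sub>0) = 0\<close>.\<close>
    define \<epsilon> where "\<epsilon> n = \<delta> / real (Suc n)" for n
    have \<epsilon>: "0 < \<epsilon> n" "\<epsilon> n \<le> \<delta>" for n using \<delta>(1) by (auto simp: \<epsilon>_def field_simps)
    have \<epsilon>lim: "\<epsilon> \<longlonglongrightarrow> 0" unfolding \<epsilon>_def by real_asymp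
    define t where "t n = complex_of_real (\<sigma>\<^sub>0 + \<epsilon> n)" for n
    have "(\<lambda>n. of_real (\<epsilon> n) * local_zeta f (\<lambda>z. of_real (\<phi> z)) (t n)) \<longlonglongrightarrow> 0"
      unfolding t_def \<sigma>\<^sub>0_def
    proof (rule zeta_residue_vanishes[OF \<phi>])
      show "\<epsilon> n \<le> 1 / b" for n using \<epsilon>(2) \<delta>(5) by (rule order_trans)
    qed (use \<epsilon>(1) \<epsilon>lim in auto)
    hence lim0: "(\<lambda>n. cmod (of_real (\<epsilon> n) * local_zeta f (\<lambda>z. of_real (\<phi> z)) (t n))) \<longlonglongrightarrow> 0"
      by (simp add: tendsto_norm_zero)
    have le: "cmod (P (t n)) \<le> cmod (of_real (\<epsilon> n) * local_zeta f (\<lambda>z. of_real (\<phi> z)) (t n))" for n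
    proof -
      have d: "dist s\<^sub>0 (t n) = \<epsilon> n" using \<epsilon>(1)[of n] by (simp add: s\<^sub>0_def t_def dist_norm)
      have ts: "t n - s\<^sub>0 = of_real (\<epsilon> n)" by (simp add: t_def s\<^sub>0_def)
      have "local_zeta f (\<lambda>z. of_real (\<phi> z)) (t n) = g (t n)"
        using eq[of "t n"] d \<epsilon>[of n] \<delta> unfolding s\<^sub>0_def[symmetric] \<sigma>\<^sub>0_def[symmetric]
        by (simp add: t_def)
      also have "g (t n) = P (t n) / of_real (\<epsilon> n) ^ Suc m"
      proof -
        have "t n \<noteq> s\<^sub>0" using ts \<epsilon>(1)[of n] by auto
        thus ?thesis using r(5)[of "t n"] d \<epsilon>[of n] \<delta> ts m by (auto simp: P_def)
      qed
      finally have "cmod (of_real (\<epsilon> n) * local_zeta f (\<lambda>z. of_real (\<phi> z)) (t n)) = cmod (P (t n)) / \<epsilon> n ^ m"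
        using \<epsilon>(1)[of n] by (simp add: norm_mult norm_divide norm_power)
      moreover have "\<epsilon> n ^ m \<le> 1" using \<epsilon>[of n] \<delta> by (intro power_le_one) auto
      hence "cmod (P (t n)) / 1 \<le> cmod (P (t n)) / \<epsilon> n ^ m"
        using \<epsilon>(1)[of n] by (intro divide_left_mono) auto
      ultimately show ?thesis by (simp only: div_by_1)
    qed
    have "(\<lambda>n. cmod (P (t n))) \<longlonglongrightarrow> 0"
      by (rule tendsto_sandwich[OF _ _ tendsto_const lim0]) (use le in auto)
    moreover have "(\<lambda>n. cmod (P (t n))) \<longlonglongrightarrow> cmod (P s\<^sub>0)"
    proof (intro tendsto_norm isCont_tendsto_compose[where g = P])
      have "P holomorphic_on ball s\<^sub>0 r"
        using r(4) unfolding P_def by (rule holomorphic_on_subset) auto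
      thus "isCont P s\<^sub>0"
        using r(1) by (auto simp: continuous_on_eq_continuous_at dest!: holomorphic_on_imp_continuous_on)
      have "(\<lambda>n. \<sigma>\<^sub>0 + \<epsilon> n) \<longlonglongrightarrow> \<sigma>\<^sub>0 + 0" by (intro tendsto_intros \<epsilon>lim)
      from tendsto_of_real[OF this]
      show "t \<longlonglongrightarrow> s\<^sub>0" unfolding t_def s\<^sub>0_def by (simp only: add_0_right)
    qed
    ultimately have "cmod (P s\<^sub>0) = 0" using LIMSEQ_unique by blast
    thus False using r(3) by (simp add: P_def)
  next
    case removable
    define h where "h = remove_sings g"
    \<comment> \<open>A third, since the disc of radius \<open>2 R\<close> around \<open>\<sigma>\<^sub>0 + R\<close> reaches up to \<open>\<sigma>\<^sub>0 + 3 R\<close>.\<close>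
    define R where "R = min e e' / 3"
    have R: "R > 0" "3 * R \<le> e" "3 * R \<le> e'" using e e' by (auto simp: R_def)
    have "h analytic_on ball s\<^sub>0 e'"
    proof (subst analytic_on_analytic_at, intro ballI)
      fix s assume s: "s \<in> ball s\<^sub>0 e'"
      show "h analytic_on {s}"
      proof (cases "s = s\<^sub>0")
        case True
        show ?thesis unfolding True h_def
          by (rule remove_sings_analytic_at[OF \<open>isolated_singularity_at g s\<^sub>0\<close> removable])
      next
        case False
        show ?thesis unfolding h_def
          by (rule remove_sings_analytic_on, rule analytic_on_subset[OF e'(2)]) (use False s in auto)
      qed
    qed
    hence hol: "h holomorphic_on ball s\<^sub>0 e'" by (rule analytic_imp_holomorphic)
    have ball: "dist s\<^sub>0 s < r + R" if "s \<in> ball (of_real (\<sigma>\<^sub>0 + R)) r" for s r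
    proof -
      have "dist s\<^sub>0 (of_real (\<sigma>\<^sub>0 + R)) = R" using R by (simp add: s\<^sub>0_def dist_norm)
      thus ?thesis using that dist_triangle[of s\<^sub>0 s "of_real (\<sigma>\<^sub>0 + R)"] by simp
    qed
    have "(\<integral>\<^sup>+ z. exp (- (\<sigma>\<^sub>0 - R/2) * weight z) * cut \<phi> z \<partial>lborel) < \<infinity>"
    proof (rule landau_convergence[where \<sigma>\<^sub>0 = \<sigma>\<^sub>0 and R = R and h = h])
      have cut: "cut (\<lambda>z. complex_of_real (\<phi> z)) = (\<lambda>z. complex_of_real (cut \<phi> z))"
        by (auto simp: cut_def)
      show "laplace_convergent lborel weight (\<lambda>z. complex_of_real (cut \<phi> z)) \<sigma>\<^sub>0"
        using laplace_convergent_cut[OF \<phi>] by (simp add: cut \<sigma>\<^sub>0_def)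
      show "cut \<phi> z \<ge> 0" for z using nn by (simp add: cut_def)
      show "h holomorphic_on ball (complex_of_real (\<sigma>\<^sub>0 + R)) (2 * R)"
        using hol by (rule holomorphic_on_subset) (use ball[of _ "2 * R"] R in force)
      fix s assume s: "s \<in> ball (complex_of_real (\<sigma>\<^sub>0 + R)) R"
      have Re: "\<sigma>\<^sub>0 < Re s"
        using s abs_Re_le_cmod[of "of_real (\<sigma>\<^sub>0 + R) - s"] by (auto simp: dist_norm)
      have d: "dist s\<^sub>0 s < 2 * R" using ball[OF s] by simp
      have "s \<noteq> s\<^sub>0" using Re by (auto simp: s\<^sub>0_def)
      hence "g analytic_on {s}" by (intro analytic_on_subset[OF e'(2)]) (use d R in auto)
      hence "h s = g s" by (simp add: h_def)
      also have "\<dots> = local_zeta f (\<lambda>z. of_real (\<phi> z)) s"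
        by (rule eq) (use d R Re in \<open>auto simp: s\<^sub>0_def \<sigma>\<^sub>0_def\<close>)
      finally show "h s = laplace lborel weight (\<lambda>z. complex_of_real (cut \<phi> z)) s"
        by (simp add: local_zeta_eq_laplace[OF supp] cut)
    qed (use R in auto)
    also have "(\<integral>\<^sup>+ z. exp (- (\<sigma>\<^sub>0 - R/2) * weight z) * cut \<phi> z \<partial>lborel)
        = (\<integral>\<^sup>+ z. \<bar>f z\<bar> powr (\<sigma>\<^sub>0 - R/2) * \<phi> z \<partial>lborel)"
    proof (intro nn_integral_cong arg_cong[where f = ennreal])
      fix z show "exp (- (\<sigma>\<^sub>0 - R/2) * weight z) * cut \<phi> z = \<bar>f z\<bar> powr (\<sigma>\<^sub>0 - R/2) * \<phi> z"
        using exp_weight(1)[of z "\<sigma>\<^sub>0 - R/2"] subsetD[OF supp, of z]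
        by (cases "\<phi> z = 0") (auto simp: cut_def)
    qed
    also have "\<dots> = \<infinity>"
    proof -
      have "continuous_on UNIV (\<lambda>z. Re (complex_of_real (\<phi> z)))"
        by (intro continuous_on_Re test_function_facts(1)[OF \<phi>])
      hence "isCont \<phi> (0, 0)" by (simp add: continuous_on_eq_continuous_at)
      hence "\<forall>\<^sub>F z in at (0, 0). \<phi> z > \<phi> (0, 0) / 2"
        using pos unfolding isCont_def by (intro order_tendstoD(1)[where y = "\<phi> (0, 0)"]) auto
      then obtain \<eta> where \<eta>: "\<eta> > 0" "\<And>z. z \<noteq> (0, 0) \<Longrightarrow> dist z (0, 0) < \<eta> \<Longrightarrow> \<phi> z > \<phi> (0, 0) / 2"
        unfolding eventually_at by blast
      show ?thesis
      proof (rule integral_diverges[where \<kappa> = "\<phi> (0, 0) / 2" and \<eta> = "\<eta> / 2"])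
        fix x y assume xy: "0 < x" "x < \<eta> / 2" "0 < y" "y < \<eta> / 2"
        have "norm (x, y) \<le> norm x + norm y" by (rule norm_Pair_le)
        hence "dist (x, y) (0, 0) < \<eta>" using xy by (simp add: dist_norm)
        thus "\<phi> (0, 0) / 2 \<le> \<phi> (x, y)" using \<eta>(2)[of "(x, y)"] xy by simp
      qed (use nn pos \<eta> R in \<open>auto simp: \<sigma>\<^sub>0_def\<close>)
    qed
    finally show False by simp
  qed
qed

section \<open>The abscissa \<open>m0\<close>\<close>

lemma m0_at_ge:
  assumes \<phi>: "\<phi> \<in> test_functions U" "U \<subseteq> ball (0, 0) (1/2)"
  shows "ereal (1/b) \<le> m0_at f \<phi>"
  unfolding m0_at_def
proof (rule Sup_upper, rule CollectI, intro exI conjI refl)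
  let ?H = "right_half_plane (- (1/b))"
  show "1 / real b > 0" using ab by simp
  show op: "open ?H" unfolding right_half_plane_def by (rule open_halfspace_Re_gt)
  show "connected ?H" unfolding right_half_plane_def
    by (intro convex_connected convex_halfspace_Re_gt)
  show "?H \<subseteq> ?H" ..
  have "local_zeta f \<phi> meromorphic_on ?H"
    using zeta_on_half_plane(2)[OF \<phi>] op by (intro analytic_on_imp_meromorphic_on) (simp add: analytic_on_open)
  thus "meromorphically_continuable (local_zeta f \<phi>) (right_half_plane 0) ?H"
    unfolding meromorphically_continuable_def by blast
qed (rule refl)

text \<open>A continuation \<open>g\<close> to a larger half-plane is only known to agree with the zeta function on \<open>Re s > 0\<close>.
  By the identity theorem the two agree on \<open>Re s > -1/b\<close> up to isolated points, and in a punctured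
  disc around \<open>-1/b\<close> where \<open>g\<close> is holomorphic they agree everywhere by continuity.\<close>

lemma m0_at_le:
  fixes \<phi> :: "real \<times> real \<Rightarrow> real"
  assumes \<phi>: "(\<lambda>z. complex_of_real (\<phi> z)) \<in> test_functions U" "U \<subseteq> ball (0, 0) (1/2)"
    and nn: "\<And>z. \<phi> z \<ge> 0" and pos: "\<phi> (0, 0) > 0"
  shows "m0_at f (\<lambda>z. complex_of_real (\<phi> z)) \<le> ereal (1/b)"
  unfolding m0_at_def
proof (rule Sup_least, clarsimp simp del: of_real_divide, rule ccontr)
  let ?Z = "local_zeta f (\<lambda>z. complex_of_real (\<phi> z))"
  define s\<^sub>0 where "s\<^sub>0 = complex_of_real (- (1 / b))"
  fix \<rho> D
  assume D: "open D" "right_half_plane (- \<rho>) \<subseteq> D"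
    and cont: "meromorphically_continuable ?Z (right_half_plane 0) D" and \<rho>: "\<not> \<rho> \<le> 1 / real b"
  have b: "real b > 0" using ab by simp
  let ?H = "right_half_plane (- (1/b))"
  have HD: "?H \<subseteq> D" and s0D: "s\<^sub>0 \<in> D"
    using D \<rho> by (auto simp: right_half_plane_def s\<^sub>0_def)
  obtain g where g: "g meromorphic_on D" "\<And>s. s \<in> right_half_plane 0 \<inter> D \<Longrightarrow> g s = ?Z s"
    using cont unfolding meromorphically_continuable_def by blast
  have opH: "open ?H" unfolding right_half_plane_def by (rule open_halfspace_Re_gt)
  have cH: "connected ?H" unfolding right_half_plane_def
    by (intro convex_connected convex_halfspace_Re_gt)
  have Z_ana: "?Z analytic_on ?H"
    using zeta_on_half_plane(2)[OF \<phi>] opH by (simp add: analytic_on_open)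
  have mer: "(\<lambda>s. g s - ?Z s) meromorphic_on ?H"
    using meromorphic_on_subset[OF g(1) HD] analytic_on_imp_meromorphic_on[OF Z_ana]
    by (rule meromorphic_on_diff)
  have ev: "\<forall>\<^sub>F w in at s. g w - ?Z w = 0" if "s \<in> ?H" for s
  proof -
    have neg: "- (1 / real b) < 0" using b by simp
    hence "- (1 / real b) < Re 1" unfolding one_complex.sel by linarith
    hence one: "1 \<in> ?H" by (simp only: right_half_plane_def mem_Collect_eq)
    have "open (right_half_plane 0)" unfolding right_half_plane_def by (rule open_halfspace_Re_gt)
    hence "\<forall>\<^sub>F w in at 1. w \<in> right_half_plane 0"
      by (rule eventually_at_in_open') (simp add: right_half_plane_def)
    moreover have "right_half_plane 0 \<subseteq> D"
    proof
      fix w assume "w \<in> right_half_plane 0"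
      hence "0 < Re w" by (simp add: right_half_plane_def)
      with neg have "- (1 / real b) < Re w" by (rule less_trans)
      thus "w \<in> D" using HD by (auto simp only: right_half_plane_def)
    qed
    ultimately have "\<forall>\<^sub>F w in at 1. g w - ?Z w = 0"
      by (auto elim!: eventually_mono simp: g(2) subset_iff)
    hence "\<not> (\<forall>\<^sub>F w in at 1. g w - ?Z w \<noteq> 0)"
      by (auto dest: eventually_conj simp: eventually_False)
    hence "\<not> (\<forall>\<^sub>\<approx>w\<in>?H. g w - ?Z w \<noteq> 0)"
      using one by (auto simp: eventually_cosparse_open_eq[OF opH])
    with meromorphic_imp_constant_or_avoid[OF mer opH cH, of 0]
    have "\<forall>\<^sub>\<approx>w\<in>?H. g w - ?Z w = 0" by blast
    thus ?thesis using that by (auto simp: eventually_cosparse_open_eq[OF opH])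
  qed
  have g0: "g meromorphic_on {s\<^sub>0}" using meromorphic_on_subset[OF g(1)] s0D by blast
  then obtain e where e: "e > 0" "g analytic_on ball s\<^sub>0 e - {s\<^sub>0}"
    using meromorphic_on_isolated_singularity unfolding isolated_singularity_at_def by blast
  show False
  proof (rule no_meromorphic_germ[OF \<phi> nn pos g0[unfolded s\<^sub>0_def] e(1)])
    fix s assume s: "s \<in> ball (complex_of_real (- (1 / b))) e" "- (1 / b) < Re s"
    have sH: "s \<in> ?H" using s by (simp add: right_half_plane_def)
    have "g analytic_on {s}"
      by (rule analytic_on_subset[OF e(2)]) (use s in \<open>auto simp: s\<^sub>0_def\<close>)
    moreover have "?Z analytic_on {s}" by (rule analytic_on_subset[OF Z_ana]) (use sH in auto)
    ultimately have "isCont (\<lambda>w. g w - ?Z w) s"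
      by (intro analytic_at_imp_isCont analytic_on_diff)
    hence "((\<lambda>w. g w - ?Z w) \<longlongrightarrow> g s - ?Z s) (at s)" by (simp add: isCont_def)
    moreover have "((\<lambda>w. g w - ?Z w) \<longlongrightarrow> 0) (at s)" by (rule tendsto_eventually[OF ev[OF sH]])
    ultimately have "g s - ?Z s = 0" by (rule LIM_unique)
    thus "g s = ?Z s" by simp
  qed
qed

end

theorem corollary3p6:
  fixes a b q q' :: nat and p p' :: real and f :: "real \<times> real \<Rightarrow> real"
  assumes "2 \<le> a" and "a < b"
    and "p > 0" and "p' > 0"
    and "even q" and "2 \<le> q" and "q \<le> b"
    and "even q'" and "2 \<le> q'" and "q' \<le> a"
    and f_def: "f = (\<lambda>(x, y). x ^ a * y ^ b + x ^ a * y ^ (b - q) * flat_exp p x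
                              + x ^ (a - q') * y ^ b * flat_exp p' y)"
  shows "\<exists>r>0. \<forall>U. open U \<and> (0, 0) \<in> U \<and> U \<subseteq> ball (0, 0) r \<longrightarrow>
           (\<forall>\<phi> \<in> test_functions U.
              (\<forall>s \<in> right_half_plane (- (1 / real b)). integrable lborel (zeta_integrand f \<phi> s)) \<and>
              local_zeta f \<phi> holomorphic_on right_half_plane (- (1 / real b))) \<and>
           (\<forall>\<phi> :: real \<times> real \<Rightarrow> real.
              (\<lambda>z. complex_of_real (\<phi> z)) \<in> test_functions U \<and> \<phi> (0, 0) > 0 \<and> (\<forall>z\<in>U. \<phi> z \<ge> 0) \<longrightarrow>
              \<not> (\<exists>V. open V \<and> - (1 / of_nat b) \<in> V \<and>
                   meromorphically_continuable (local_zeta f (\<lambda>z. complex_of_real (\<phi> z)))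
                     (right_half_plane (- (1 / real b))) V)) \<and>
           m0 U f = ereal (1 / real b)"
proof -
  interpret fp: flat_perturbation a b q q' p p' by standard (use assms in auto)
  have f: "f = fp.f" unfolding f_def fp.f_def ..
  \<comment> \<open>On \<open>ball (0, 0) (1/2)\<close> one has \<open>\<bar>f\<bar> < 1\<close>, so that the weight \<open>- ln \<bar>f\<bar>\<close> is nonnegative.\<close>
  show ?thesis unfolding f
  proof (intro exI[of _ "1/2"] conjI allI impI ballI; (elim conjE)?)
    fix U :: "(real \<times> real) set"
    assume U: "open U" "(0, 0) \<in> U" "U \<subseteq> ball (0, 0) (1/2)"
    show "integrable lborel (zeta_integrand fp.f \<phi> s)"
      if "\<phi> \<in> test_functions U" "s \<in> right_half_plane (- (1 / real b))" for \<phi> s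
      using fp.zeta_on_half_plane(1)[OF that(1) U(3) that(2)] .
    show "local_zeta fp.f \<phi> holomorphic_on right_half_plane (- (1 / real b))"
      if "\<phi> \<in> test_functions U" for \<phi>
      using fp.zeta_on_half_plane(2)[OF that U(3)] .
    show "\<not> (\<exists>V. open V \<and> - (1 / of_nat b) \<in> V \<and>
             meromorphically_continuable (local_zeta fp.f (\<lambda>z. complex_of_real (\<phi> z)))
               (right_half_plane (- (1 / real b))) V)"
      if \<phi>: "(\<lambda>z. complex_of_real (\<phi> z)) \<in> test_functions U" "\<phi> (0, 0) > 0" "\<forall>z\<in>U. \<phi> z \<ge> 0"
      for \<phi> :: "real \<times> real \<Rightarrow> real"
    proof clarify
      fix V assume V: "open V" "- (1 / of_nat b) \<in> V"
        and "meromorphically_continuable (local_zeta fp.f (\<lambda>z. complex_of_real (\<phi> z)))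
               (right_half_plane (- (1 / real b))) V"
      then obtain g where g: "g meromorphic_on V"
        "\<And>s. s \<in> right_half_plane (- (1 / real b)) \<inter> V \<Longrightarrow> g s = local_zeta fp.f (\<lambda>z. complex_of_real (\<phi> z)) s"
        unfolding meromorphically_continuable_def by blast
      have s0: "complex_of_real (- (1 / b)) \<in> V" using V(2) by simp
      obtain e where e: "e > 0" "ball (complex_of_real (- (1 / b))) e \<subseteq> V"
        using V(1) s0 open_contains_ball by blast
      have nn: "\<phi> z \<ge> 0" for z
        using \<phi>(3) fp.test_function_facts(2)[OF \<phi>(1) U(3), of z] by (cases "\<phi> z = 0") auto
      show False
        by (rule fp.no_meromorphic_germ[OF \<phi>(1) U(3) nn \<phi>(2) meromorphic_on_subset[OF g(1)] e(1)])
           (use s0 e(2) in \<open>auto intro!: g(2) simp: right_half_plane_def\<close>)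
    qed
    show "m0 U fp.f = ereal (1 / real b)"
    proof (rule antisym)
      obtain \<phi> :: "real \<times> real \<Rightarrow> real" where \<phi>: "(\<lambda>z. complex_of_real (\<phi> z)) \<in> test_functions U"
        "\<phi> (0, 0) > 0" "\<And>z. \<phi> z \<ge> 0"
        using ex_bump_function[OF U(1,2)] by blast
      show "m0 U fp.f \<le> ereal (1 / real b)"
        unfolding m0_def
        using INF_lower[OF \<phi>(1)] fp.m0_at_le[OF \<phi>(1) U(3) \<phi>(3,2)] by (rule order_trans)
      show "ereal (1 / real b) \<le> m0 U fp.f"
        unfolding m0_def by (rule INF_greatest) (rule fp.m0_at_ge[OF _ U(3)])
    qed
  qed simp
qed

end
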